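(* Let $d\ge2$ and $0\neq f\in\mathcal{R}_d$. Choose a matrix $E\in M_f$ such that $E\,\partial f=\partial f$ and $\operatorname{rank}E=\dim_KR_{d-1}(f)$. Let $$\mathrm{Coid}(M_f^E)=\Bigl\{\{E_i\}_{i=1}^n : 0\ne E_i\in M_f^E,\ \sum_{i=1}^nE_i=E \text{ and } E_iE_j=0 \text{ for all } i\ne j\Bigr\},$$ $$\mathrm{Reg}(f)=\Bigl\{\{g_1,\dots,g_n\} : f=g_1+\dots+g_n \text{ is a regular splitting of } f\Bigr\}.$$ Then the map $\{E_i\}_{i=1}^n\mapsto\{g_i=\gamma_f(E_i)\}_{i=1}^n$ defines a bijection $\mathrm{Coid}(M_f^E)\to\mathrm{Reg}(f)$. Assume moreover $d\ge3$. Then $M_f^E$ is a commutative $K$-algebra (with identity element $E$), and there exists a unique maximal regular splitting of $f$ (a unique regular splitting of maximal length, from which every other regular splitting is obtained by grouping summands). If $\{E_1,\dots,E_n\}$ is a complete set of orthogonal idempotents in $M_f^E$ and $g_i=\gamma_f(E_i)$, then $$M_{g_i}^{E_i}=M_fE_i=M_f^EE_i\ \text{ for all } i,\qquad\text{and}\qquad M_f^E=\bigoplus_{i=1}^nM_{g_i}^{E_i}.$$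
   Context: $K$ is a field, $r\ge 1$, $R=K[\partial_1,\dots,\partial_r]$ is a polynomial ring with the standard grading, and $\mathcal{R}=K[x_1,\dots,x_r]^{DP}=\bigoplus_{d\ge0}\mathcal{R}_d$ is the divided power ring: $\mathcal{R}_d$ has $K$-basis $x^{(\alpha)}=\prod_i x_i^{(\alpha_i)}$, $|\alpha|=d$, with multiplication generated by $x_i^{(a)}x_i^{(b)}=\binom{a+b}{a}x_i^{(a+b)}$. $R$ acts on $\mathcal{R}$ by $\partial^\beta(x^{(\alpha)})=x^{(\alpha-\beta)}$ (zero if some $\alpha_i<\beta_i$). $\mathrm{ann}_R(f)=\{D\in R:Df=0\}$; $R_e(f)=\{Df:D\in R_e\}$. Put $\partial=[\partial_1,\dots,\partial_r]^T$, acting entrywise. For $A\in\mathrm{Mat}_K(r,r)$, $I_2(\partial\;A\partial)$ is the ideal of $R$ generated by the $2\times2$ minors of the $r\times2$ matrix with columns $\partial$ and $A\partial$, and for every $g\in\mathcal{R}_d$, $$M_g=\{A\in\mathrm{Mat}_K(r,r): I_2(\partial\;A\partial)\subseteq\mathrm{ann}_R(g)\}.$$ For $d>0$, $\gamma_f:M_f\to\mathcal{R}_d$ sends $A$ to the unique $g\in\mathcal{R}_d$ with $\partial g=A\,\partial f$. For an idempotent $E\in M_g$, define $M_g^E=M_g\cap E\,\mathrm{Mat}_K(r,r)\,E$; $E$ acts as the identity on $M_g^E$. (A matrix $E$ as in the claim is automatically idempotent.) A complete set of orthogonal idempotents in $M_f^E$ is an element of $\mathrm{Coid}(M_f^E)$.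 $M_fE_i$ denotes $\{AE_i:A\in M_f\}$, similarly $M_f^EE_i$. A regular splitting of $f\in\mathcal{R}_d$ of length $n$ is an expression $f=g_1+\dots+g_n$ with nonzero $g_i\in\mathcal{R}_d$ such that $R_{d-1}(g_i)\cap\sum_{j\ne i}R_{d-1}(g_j)=0$ in $\mathcal{R}_1$ for all $i$. *)

theory Defs
  imports "HOL-Analysis.Determinants" "HOL-Library.Poly_Mapping" "HOL-Library.FuncSet"
begin

text \<open>
  The variables are indexed by a finite type \<open>'n\<close> (so \<open>r = CARD('n) \<ge> 1\<close>), and an exponent vector is
  an element of \<^typ>\<open>'n \<Rightarrow>\<^sub>0 nat\<close>. An element \<open>D\<close> of the polynomial ring \<open>R\<close> stands for
  \<open>\<Sum>\<beta>. lookup D \<beta> \<cdot> \<partial>^\<beta>\<close>, and an element \<open>f\<close> of the divided power ring stands for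
  \<open>\<Sum>\<alpha>. lookup f \<alpha> \<cdot> x^(\<alpha>)\<close>, where \<open>x^(\<alpha>)\<close> is the divided monomial. Pitfall: on
  the latter type, the library product \<open>(*)\<close> is \emph{not} the divided power product. Only the
  graded \<open>K\<close>-vector space structure of the divided power ring and the action of \<open>R\<close> on it are used.
\<close>

type_synonym 'n expo = "'n \<Rightarrow>\<^sub>0 nat"
type_synonym ('a, 'n) diffop = "'n expo \<Rightarrow>\<^sub>0 'a"
type_synonym ('a, 'n) divpow = "'n expo \<Rightarrow>\<^sub>0 'a"

definition pm_scale :: "'a::field \<Rightarrow> ('e \<Rightarrow>\<^sub>0 'a) \<Rightarrow> ('e \<Rightarrow>\<^sub>0 'a)"
  where "pm_scale c p = Poly_Mapping.map ((*) c) p"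

lemma lookup_pm_scale [simp]: "Poly_Mapping.lookup (pm_scale c p) k = c * Poly_Mapping.lookup p k"
  by (simp add: pm_scale_def Poly_Mapping.map.rep_eq when_def)

interpretation pm: vector_space "pm_scale :: 'a::field \<Rightarrow> ('e \<Rightarrow>\<^sub>0 'a) \<Rightarrow> ('e \<Rightarrow>\<^sub>0 'a)"
  by unfold_locales (auto intro!: poly_mapping_eqI simp: Poly_Mapping.lookup_add algebra_simps)

definition mat_scale :: "'a::field \<Rightarrow> 'a^'m^'n \<Rightarrow> 'a^'m^'n"
  where "mat_scale c A = (\<chi> i j. c * A $ i $ j)"

interpretation matv: vector_space "mat_scale :: 'a::field \<Rightarrow> 'a^'m^'n \<Rightarrow> 'a^'m^'n"
  by unfold_locales (auto simp: mat_scale_def vec_eq_iff algebra_simps)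

text \<open>Ideals of a commutative ring are its submodules; \<open>idl.span S\<close> is the ideal generated by \<open>S\<close>.\<close>

interpretation idl: Modules.module "(*) :: 'b::comm_ring_1 \<Rightarrow> 'b \<Rightarrow> 'b"
  by unfold_locales (auto simp: algebra_simps)

definition expo_deg :: "'n::finite expo \<Rightarrow> nat"
  where "expo_deg \<alpha> = (\<Sum>i\<in>UNIV. Poly_Mapping.lookup \<alpha> i)"

definition homog :: "nat \<Rightarrow> ('n::finite expo \<Rightarrow>\<^sub>0 'a::field) set"
  where "homog d = {p. \<forall>\<alpha>\<in>Poly_Mapping.keys p. expo_deg \<alpha> = d}"

definition contract :: "('a::field, 'n::finite) diffop \<Rightarrow> ('a, 'n) divpow \<Rightarrow> ('a, 'n) divpow"
  where "contract D f = (\<Sum>\<beta>\<in>Poly_Mapping.keys D. \<Sum>\<alpha>\<in>Poly_Mapping.keys f.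
     if \<forall>i. Poly_Mapping.lookup \<beta> i \<le> Poly_Mapping.lookup \<alpha> i
     then Poly_Mapping.single (\<alpha> - \<beta>) (Poly_Mapping.lookup D \<beta> * Poly_Mapping.lookup f \<alpha>) else 0)"

lemma contract_monomials:
  "contract (Poly_Mapping.single \<beta> b) (Poly_Mapping.single \<alpha> c :: ('a::field, 'n::finite) divpow) =
     (if \<forall>i. Poly_Mapping.lookup \<beta> i \<le> Poly_Mapping.lookup \<alpha> i
      then Poly_Mapping.single (\<alpha> - \<beta>) (b * c) else 0)"
  by (simp add: contract_def)

definition ann :: "('a::field, 'n::finite) divpow \<Rightarrow> ('a, 'n) diffop set"
  where "ann f = {D. contract D f = 0}"

definition derivs :: "nat \<Rightarrow> ('a::field, 'n::finite) divpow \<Rightarrow> ('a, 'n) divpow set"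
  where "derivs e f = {contract D f | D. D \<in> homog e}"

definition partial :: "('a::field, 'n::finite) diffop ^ 'n"
  where "partial = (\<chi> i. Poly_Mapping.single (Poly_Mapping.single i 1) 1)"

definition grad :: "('a::field, 'n::finite) divpow \<Rightarrow> ('a, 'n) divpow ^ 'n"
  where "grad f = (\<chi> i. contract (partial $ i) f)"

text \<open>Product of a matrix over \<open>K\<close> with a column vector whose entries lie in a \<open>K\<close>-vector space
  (used with entries in \<open>R\<close>, for \<open>A \<partial>\<close>, and in the divided power ring, for \<open>A \<partial>f\<close>).\<close>

definition mat_app :: "'a::field ^ 'n ^ 'm \<Rightarrow> ('e \<Rightarrow>\<^sub>0 'a) ^ 'n \<Rightarrow> ('e \<Rightarrow>\<^sub>0 'a) ^ 'm"
  where "mat_app A v = (\<chi> i. \<Sum>j\<in>UNIV. pm_scale (A $ i $ j) (v $ j))"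

definition two_columns :: "'b ^ 'n \<Rightarrow> 'b ^ 'n \<Rightarrow> 'b ^ 2 ^ 'n"
  where "two_columns v w = (\<chi> i j. if j = 1 then v $ i else w $ i)"

text \<open>The order of the two rows only affects the sign of a minor, hence not the ideal.\<close>

definition I2 :: "'b::comm_ring_1 ^ 2 ^ 'n \<Rightarrow> 'b set"
  where "I2 M = idl.span {det (vector [M $ i, M $ j] :: 'b ^ 2 ^ 2) | i j. i \<noteq> j}"

definition Mset :: "('a::field, 'n::finite) divpow \<Rightarrow> ('a ^ 'n ^ 'n) set"
  where "Mset g = {A. I2 (two_columns partial (mat_app A partial)) \<subseteq> ann g}"

definition MsetE :: "('a::field, 'n::finite) divpow \<Rightarrow> 'a ^ 'n ^ 'n \<Rightarrow> ('a ^ 'n ^ 'n) set"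
  where "MsetE g E = Mset g \<inter> {E ** A ** E | A. True}"

text \<open>Meaningful for \<open>d > 0\<close>, \<open>f\<close> homogeneous of degree \<open>d\<close> and \<open>A \<in> Mset f\<close>.\<close>

definition gam :: "nat \<Rightarrow> ('a::field, 'n::finite) divpow \<Rightarrow> 'a ^ 'n ^ 'n \<Rightarrow> ('a, 'n) divpow"
  where "gam d f A = (THE g. g \<in> homog d \<and> grad g = mat_app A (grad f))"

definition subspace_sum :: "'i set \<Rightarrow> ('i \<Rightarrow> 'v::comm_monoid_add set) \<Rightarrow> 'v set"
  where "subspace_sum I V = {\<Sum>i\<in>I. v i | v. \<forall>i\<in>I. v i \<in> V i}"

definition orth_idempotents ::
    "('a::field, 'n::finite) divpow \<Rightarrow> 'a ^ 'n ^ 'n \<Rightarrow> nat \<Rightarrow> (nat \<Rightarrow> 'a ^ 'n ^ 'n) \<Rightarrow> bool"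
  where "orth_idempotents f E n Es \<longleftrightarrow>
     (\<forall>i\<in>{1..n}. Es i \<noteq> 0 \<and> Es i \<in> MsetE f E) \<and>
     (\<Sum>i\<in>{1..n}. Es i) = E \<and>
     (\<forall>i\<in>{1..n}. \<forall>j\<in>{1..n}. i \<noteq> j \<longrightarrow> Es i ** Es j = 0)"

definition regular_splitting ::
    "nat \<Rightarrow> ('a::field, 'n::finite) divpow \<Rightarrow> nat \<Rightarrow> (nat \<Rightarrow> ('a, 'n) divpow) \<Rightarrow> bool"
  where "regular_splitting d f n g \<longleftrightarrow>
     f = (\<Sum>i\<in>{1..n}. g i) \<and>
     (\<forall>i\<in>{1..n}. g i \<noteq> 0 \<and> g i \<in> homog d) \<and>
     (\<forall>i\<in>{1..n}. derivs (d - 1) (g i) \<inter>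
        subspace_sum ({1..n} - {i}) (\<lambda>j. derivs (d - 1) (g j)) = {0})"

text \<open>In both of the following, the members of an admissible family are automatically pairwise
  distinct (when \<open>f\<close> and \<open>E\<close> are as in the theorem), so passing from the family to its set of
  members loses only the numbering.\<close>

definition Coid :: "('a::field, 'n::finite) divpow \<Rightarrow> 'a ^ 'n ^ 'n \<Rightarrow> ('a ^ 'n ^ 'n) set set"
  where "Coid f E = {Es ` {1..n} | n Es. orth_idempotents f E n Es}"

definition Reg :: "nat \<Rightarrow> ('a::field, 'n::finite) divpow \<Rightarrow> ('a, 'n) divpow set set"
  where "Reg d f = {g ` {1..n} | n g. regular_splitting d f n g}"

definition max_regular_splitting ::
    "nat \<Rightarrow> ('a::field, 'n::finite) divpow \<Rightarrow> nat \<Rightarrow> (nat \<Rightarrow> ('a, 'n) divpow) \<Rightarrow> bool"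
  where "max_regular_splitting d f n g \<longleftrightarrow>
     regular_splitting d f n g \<and> (\<forall>m h. regular_splitting d f m h \<longrightarrow> m \<le> n)"

definition same_up_to_order :: "nat \<Rightarrow> (nat \<Rightarrow> 'v) \<Rightarrow> nat \<Rightarrow> (nat \<Rightarrow> 'v) \<Rightarrow> bool"
  where "same_up_to_order n g m h \<longleftrightarrow>
     (\<exists>\<sigma>. bij_betw \<sigma> {1..m} {1..n} \<and> (\<forall>j\<in>{1..m}. h j = g (\<sigma> j)))"

definition grouping_of :: "nat \<Rightarrow> (nat \<Rightarrow> 'v::comm_monoid_add) \<Rightarrow> nat \<Rightarrow> (nat \<Rightarrow> 'v) \<Rightarrow> bool"
  where "grouping_of n g m h \<longleftrightarrow>
     (\<exists>\<phi>. \<phi> ` {1..n} = {1..m} \<and> (\<forall>j\<in>{1..m}. h j = (\<Sum>i\<in>{i\<in>{1..n}. \<phi> i = j}. g i)))"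

definition commutative_matrix_algebra :: "('a::field ^ 'n ^ 'n) set \<Rightarrow> 'a ^ 'n ^ 'n \<Rightarrow> bool"
  where "commutative_matrix_algebra S e \<longleftrightarrow>
     matv.subspace S \<and> (\<forall>A\<in>S. \<forall>B\<in>S. A ** B \<in> S \<and> A ** B = B ** A) \<and>
     e \<in> S \<and> (\<forall>A\<in>S. e ** A = A \<and> A ** e = A)"

text \<open>Internal direct sum: every element of \<open>V\<close> is a sum of members of the subspaces \<open>W i\<close> in exactly
  one way, and all such sums lie in \<open>V\<close>.\<close>

definition matrix_direct_sum ::
    "('a::field ^ 'n ^ 'n) set \<Rightarrow> 'i set \<Rightarrow> ('i \<Rightarrow> ('a ^ 'n ^ 'n) set) \<Rightarrow> bool"
  where "matrix_direct_sum V I W \<longleftrightarrow>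
     (\<forall>i\<in>I. matv.subspace (W i)) \<and>
     bij_betw (\<lambda>v. \<Sum>i\<in>I. v i) (Pi\<^sub>E I W) V"

end

theory Submission
  imports Defs
begin

text \<open>
  Attach to \<open>g\<close> and an exponent \<open>\<gamma>\<close> the vector \<open>coeff_grad g \<gamma>\<close> in \<open>K\<^sup>r\<close> whose entries are the
  coefficients of \<open>x^(\<gamma>)\<close> in the partial derivatives of \<open>g\<close>, and let \<open>W = grad_space g\<close> be the
  span of these vectors. Every ingredient of the theorem becomes linear algebra on \<open>K\<^sup>r\<close>.
  The space of derivatives of order \<open>d - 1\<close> is \<open>W\<close>, read as a space of linear forms
  (\<open>derivs_eq_linear_form\<close>). A matrix \<open>A\<close> lies in \<open>M\<^sub>g\<close> iff the family
  \<open>A *v coeff_grad g \<gamma>\<close> has symmetric partial derivatives (\<open>Mset_iff\<close>), that is, iff it is the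
  gradient of some form (\<open>ex_coeff_grad\<close>); this form is \<open>gam d g A\<close>. Finally \<open>E\<close> fixes the
  vectors in \<open>W\<close> and has rank \<open>dim W\<close>, so it is a projection onto \<open>W\<close>
  (\<open>grad_projectionI\<close>).

  Let \<open>A\<close> be in \<open>M\<^sub>f\<close>. Symmetry of second derivatives lets \<open>A\<close> act on the exponent instead of
  on the vector: \<open>A\<close> sends \<open>coeff_grad f (\<gamma> + e\<^sub>i)\<close> to the combination of the vectors
  \<open>coeff_grad f (\<gamma> + e\<^sub>k)\<close> with coefficients from row \<open>i\<close> of \<open>A\<close> (\<open>Mset_apply\<close>). This has two
  consequences. For \<open>d \<ge> 2\<close> the exponents that matter are nonzero, so \<open>A\<close> maps \<open>W\<close> into
  itself; hence the elements of \<open>M\<^sub>f\<^sup>E\<close> are the products \<open>A E\<close>, and they are determined by their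
  restriction to \<open>W\<close>. For \<open>d \<ge> 3\<close> these exponents have room for two unit vectors, on which two
  elements of \<open>M\<^sub>f\<close> act independently; so they commute on \<open>W\<close>, and \<open>M\<^sub>f\<close> is closed under
  products.

  The images of orthogonal idempotents with sum \<open>E\<close> decompose \<open>W\<close> into a direct sum, and this
  says that the forms \<open>gam d f (E\<^sub>i)\<close> are a regular splitting. Conversely, the gradient spaces
  of a regular splitting \<open>f = g\<^sub>1 + \<dots> + g\<^sub>n\<close> are independent, so there is a matrix that is the
  identity on the space of \<open>g\<^sub>i\<close> and zero on the others. It maps the gradient of \<open>f\<close> to that of
  \<open>g\<^sub>i\<close> and therefore belongs to \<open>M\<^sub>f\<close>; composed with \<open>E\<close> it is the wanted idempotent.

  The length of such a family is at most \<open>r\<close>. If \<open>d \<ge> 3\<close>, a member of a longest family cannot be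
  split further, so by commutativity its product with any idempotent of \<open>M\<^sub>f\<^sup>E\<close> is zero or
  itself. Hence each member lies below exactly one member of any other family, which
  exhibits the other family as a grouping of the longest one. Two longest families
  are groupings of each other, so they agree up to order.
\<close>


section \<open>Coefficients of contractions\<close>

abbreviation lookup :: "('e \<Rightarrow>\<^sub>0 'b::zero) \<Rightarrow> 'e \<Rightarrow> 'b"
  where "lookup \<equiv> Poly_Mapping.lookup"

abbreviation keys :: "('e \<Rightarrow>\<^sub>0 'b::zero) \<Rightarrow> 'e set"
  where "keys \<equiv> Poly_Mapping.keys"

definition unit_expo :: "'n \<Rightarrow> 'n expo"
  where "unit_expo i = Poly_Mapping.single i 1"

lemma lookup_unit_expo [simp]: "lookup (unit_expo i) k = (if k = i then 1 else 0)"
  by (simp add: unit_expo_def lookup_single when_def)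

lemma partial_nth: "partial $ i = Poly_Mapping.single (unit_expo i) 1"
  by (simp add: partial_def unit_expo_def)

lemma lookup_contract:
  fixes D :: "('a::field, 'n::finite) diffop"
  shows "lookup (contract D f) \<gamma> = (\<Sum>\<beta>\<in>keys D. lookup D \<beta> * lookup f (\<gamma> + \<beta>))"
proof -
  have inner: "(\<Sum>\<alpha>\<in>keys f. lookup (if \<forall>i. lookup \<beta> i \<le> lookup \<alpha> i
      then Poly_Mapping.single (\<alpha> - \<beta>) (lookup D \<beta> * lookup f \<alpha>) else 0) \<gamma>)
      = lookup D \<beta> * lookup f (\<gamma> + \<beta>)" for \<beta>
  proof -
    have "(\<forall>i. lookup \<beta> i \<le> lookup \<alpha> i) \<and> \<alpha> - \<beta> = \<gamma> \<longleftrightarrow> \<alpha> = \<gamma> + \<beta>" for \<alpha>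
    proof
      assume *: "(\<forall>i. lookup \<beta> i \<le> lookup \<alpha> i) \<and> \<alpha> - \<beta> = \<gamma>"
      show "\<alpha> = \<gamma> + \<beta>"
      proof (rule poly_mapping_eqI)
        fix k
        have "lookup \<gamma> k = lookup \<alpha> k - lookup \<beta> k"
          using * by (auto simp: lookup_minus)
        then show "lookup \<alpha> k = lookup (\<gamma> + \<beta>) k"
          using * by (simp add: lookup_add)
      qed
    qed (auto simp: lookup_add)
    then have "(\<Sum>\<alpha>\<in>keys f. lookup (if \<forall>i. lookup \<beta> i \<le> lookup \<alpha> i
        then Poly_Mapping.single (\<alpha> - \<beta>) (lookup D \<beta> * lookup f \<alpha>) else 0) \<gamma>)
      = (\<Sum>\<alpha>\<in>keys f. if \<alpha> = \<gamma> + \<beta> then lookup D \<beta> * lookup f \<alpha> else 0)"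
      by (intro sum.cong refl) (auto simp: lookup_single when_def)
    also have "\<dots> = lookup D \<beta> * lookup f (\<gamma> + \<beta>)"
      by (simp add: in_keys_iff)
    finally show ?thesis .
  qed
  show ?thesis
    unfolding contract_def by (simp only: lookup_sum inner)
qed

lemma lookup_contract_superset:
  fixes D :: "('a::field, 'n::finite) diffop"
  assumes "finite S" "keys D \<subseteq> S"
  shows "lookup (contract D f) \<gamma> = (\<Sum>\<beta>\<in>S. lookup D \<beta> * lookup f (\<gamma> + \<beta>))"
  unfolding lookup_contract
  by (rule sum.mono_neutral_left) (use assms in \<open>auto simp: in_keys_iff\<close>)

lemma contract_zero_left [simp]: "contract 0 f = 0"
  by (simp add: contract_def)

lemma contract_zero_right [simp]: "contract D 0 = 0"
  by (simp add: contract_def)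

lemma contract_add: "contract (D + D') f = contract D f + contract D' f"
  for D :: "('a::field, 'n::finite) diffop"
proof (rule poly_mapping_eqI)
  fix \<gamma>
  have S: "finite (keys D \<union> keys D')"
    by simp
  show "lookup (contract (D + D') f) \<gamma> = lookup (contract D f + contract D' f) \<gamma>"
    unfolding lookup_add lookup_contract_superset[OF S Poly_Mapping.keys_add]
      lookup_contract_superset[OF S Un_upper1] lookup_contract_superset[OF S Un_upper2]
    by (simp add: distrib_right sum.distrib)
qed

lemma contract_scale: "contract (pm_scale c D) f = pm_scale c (contract D f)"
  for D :: "('a::field, 'n::finite) diffop"
proof (rule poly_mapping_eqI)
  fix \<gamma>
  have "keys (pm_scale c D) \<subseteq> keys D"
    by (auto simp: in_keys_iff)
  then show "lookup (contract (pm_scale c D) f) \<gamma> = lookup (pm_scale c (contract D f)) \<gamma>"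
    unfolding lookup_pm_scale lookup_contract[of D] lookup_contract_superset[OF finite_keys \<open>keys (pm_scale c D) \<subseteq> keys D\<close>]
    by (simp only: sum_distrib_left mult.assoc)
qed

lemma contract_sum: "contract (\<Sum>i\<in>I. D i) f = (\<Sum>i\<in>I. contract (D i) f)"
  for D :: "'i \<Rightarrow> ('a::field, 'n::finite) diffop"
  by (induction I rule: infinite_finite_induct) (simp_all add: contract_add)

lemma contract_diff: "contract (D - D') f = contract D f - contract D' f"
  for D :: "('a::field, 'n::finite) diffop"
  using contract_add[of "D - D'" D' f] by simp

lemma lookup_contract_single:
  "lookup (contract (Poly_Mapping.single \<beta> b) f) \<gamma> = b * lookup f (\<gamma> + \<beta>)"
  for f :: "('a::field, 'n::finite) divpow"
  by (simp add: lookup_contract)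

text \<open>
  The expansion into monomials reduces the multiplicativity of the action to
  \<open>\<partial>^\<beta> \<partial>^\<beta>' = \<partial>^(\<beta> + \<beta>')\<close>.
\<close>

lemma sum_single_keys: "D = (\<Sum>\<beta>\<in>keys D. Poly_Mapping.single \<beta> (lookup D \<beta>))"
proof (rule poly_mapping_eqI)
  fix \<gamma>
  show "lookup D \<gamma> = lookup (\<Sum>\<beta>\<in>keys D. Poly_Mapping.single \<beta> (lookup D \<beta>)) \<gamma>"
    by (simp add: lookup_sum lookup_single when_def in_keys_iff)
qed

lemma contract_mult: "contract (D * D') f = contract D (contract D' f)"
  for D :: "('a::field, 'n::finite) diffop"
proof (rule poly_mapping_eqI)
  fix \<gamma>
  have "D * D' = (\<Sum>\<beta>\<in>keys D. \<Sum>\<beta>'\<in>keys D'.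
      Poly_Mapping.single (\<beta> + \<beta>') (lookup D \<beta> * lookup D' \<beta>'))"
    by (subst sum_single_keys[of D], subst sum_single_keys[of D'])
      (simp add: sum_product mult_single)
  then have "lookup (contract (D * D') f) \<gamma> = (\<Sum>\<beta>\<in>keys D. \<Sum>\<beta>'\<in>keys D'.
      lookup D \<beta> * lookup D' \<beta>' * lookup f (\<gamma> + (\<beta> + \<beta>')))"
    by (simp add: contract_sum lookup_sum lookup_contract_single)
  also have "\<dots> = lookup (contract D (contract D' f)) \<gamma>"
    by (simp only: lookup_contract sum_distrib_left mult.assoc add.assoc)
  finally show "lookup (contract (D * D') f) \<gamma> = lookup (contract D (contract D' f)) \<gamma>" .
qed

lemma expo_deg_add: "expo_deg (\<alpha> + \<beta>) = expo_deg \<alpha> + expo_deg \<beta>"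
  by (simp add: expo_deg_def lookup_add sum.distrib)

lemma expo_deg_unit [simp]: "expo_deg (unit_expo i) = 1"
  by (simp add: expo_deg_def)

lemma expo_unit_cases:
  fixes \<alpha> :: "'n expo"
  assumes "\<alpha> \<noteq> 0"
  obtains \<gamma> i where "\<alpha> = \<gamma> + unit_expo i"
proof -
  obtain i where i: "lookup \<alpha> i \<noteq> 0"
    using assms by (metis lookup_zero poly_mapping_eqI)
  have "\<alpha> = (\<alpha> - unit_expo i) + unit_expo i"
  proof (rule poly_mapping_eqI)
    fix k
    show "lookup \<alpha> k = lookup (\<alpha> - unit_expo i + unit_expo i) k"
      using i by (cases "k = i") (simp_all add: lookup_add lookup_minus)
  qed
  then show thesis
    using that by blast
qed

lemma expo_deg_zero_iff: "expo_deg \<alpha> = 0 \<longleftrightarrow> \<alpha> = 0"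
proof
  show "\<alpha> = 0" if "expo_deg \<alpha> = 0"
  proof (rule ccontr)
    assume "\<alpha> \<noteq> 0"
    then obtain \<gamma> i where "\<alpha> = \<gamma> + unit_expo i"
      by (rule expo_unit_cases)
    then show False
      using that by (simp add: expo_deg_add)
  qed
qed (simp add: expo_deg_def)

lemma homog_lookup: "p \<in> homog d \<longleftrightarrow> (\<forall>\<alpha>. lookup p \<alpha> \<noteq> 0 \<longrightarrow> expo_deg \<alpha> = d)"
  by (simp add: homog_def Ball_def in_keys_iff)


section \<open>The gradient as a family of vectors\<close>

definition coeff_grad :: "('a::field, 'n::finite) divpow \<Rightarrow> 'n expo \<Rightarrow> 'a ^ 'n"
  where "coeff_grad g \<gamma> = (\<chi> i. lookup g (\<gamma> + unit_expo i))"

lemma lookup_grad: "lookup (grad g $ i) \<gamma> = coeff_grad g \<gamma> $ i"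
  by (simp add: grad_def partial_nth lookup_contract_single coeff_grad_def)

lemma lookup_mat_app: "lookup (mat_app A v $ i) \<gamma> = (A *v (\<chi> j. lookup (v $ j) \<gamma>)) $ i"
  by (simp add: mat_app_def matrix_vector_mult_def lookup_sum)

lemma grad_eq_mat_app_iff:
  "grad g = mat_app A (grad f) \<longleftrightarrow> (\<forall>\<gamma>. coeff_grad g \<gamma> = A *v coeff_grad f \<gamma>)"
proof -
  have "(\<chi> j. coeff_grad f \<gamma> $ j) = coeff_grad f \<gamma>" for \<gamma>
    by (simp add: vec_eq_iff)
  then show ?thesis
    by (auto simp: vec_eq_iff poly_mapping_eq_iff fun_eq_iff lookup_mat_app lookup_grad)
qed

lemma coeff_grad_degree:
  assumes "g \<in> homog d" "coeff_grad g \<gamma> \<noteq> 0"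
  shows "Suc (expo_deg \<gamma>) = d"
  using assms by (auto simp: coeff_grad_def vec_eq_iff homog_lookup expo_deg_add)

lemma coeff_grad_add: "coeff_grad (g + h) \<gamma> = coeff_grad g \<gamma> + coeff_grad h \<gamma>"
  by (simp add: coeff_grad_def vec_eq_iff lookup_add)

lemma coeff_grad_zero [simp]: "coeff_grad 0 \<gamma> = 0"
  by (simp add: coeff_grad_def vec_eq_iff)

lemma coeff_grad_sum: "coeff_grad (\<Sum>i\<in>I. g i) \<gamma> = (\<Sum>i\<in>I. coeff_grad (g i) \<gamma>)"
  by (induction I rule: infinite_finite_induct) (simp_all add: coeff_grad_add)

text \<open>
  Symmetry of second derivatives; together with its converse \<open>ex_coeff_grad\<close> it characterises
  gradients.
\<close>

lemma coeff_grad_swap: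
  "coeff_grad g (\<gamma> + unit_expo i) $ j = coeff_grad g (\<gamma> + unit_expo j) $ i"
  by (simp add: coeff_grad_def add.assoc add.commute[of "unit_expo i"])

text \<open>
  The gradient determines everything except the constant term, and the constant term of a form
  of positive degree is zero.
\<close>

lemma homog_eqI:
  assumes "g \<in> homog d" "h \<in> homog d" "d > 0" "\<And>\<gamma>. coeff_grad g \<gamma> = coeff_grad h \<gamma>"
  shows "g = h"
proof (rule poly_mapping_eqI)
  fix \<alpha>
  show "lookup g \<alpha> = lookup h \<alpha>"
  proof (cases "\<alpha> = 0")
    case True
    then have "expo_deg \<alpha> \<noteq> d"
      using assms(3) expo_deg_zero_iff[of \<alpha>] by simp
    then show ?thesis
      using assms(1,2) by (metis homog_lookup)
  next
    case False
    then obtain \<gamma> i where "\<alpha> = \<gamma> + unit_expo i"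
      by (rule expo_unit_cases)
    then show ?thesis
      using assms(4)[of \<gamma>] by (simp add: coeff_grad_def vec_eq_iff)
  qed
qed

text \<open>
  A polynomial Poincare lemma, valid in every characteristic because the basis consists of divided
  powers: the coefficient at \<open>\<alpha> \<noteq> 0\<close> is read off from a derivative in any variable that occurs in
  \<open>\<alpha>\<close>, and the symmetry of second derivatives makes this independent of the chosen variable.
\<close>

lemma ex_coeff_grad:
  fixes h :: "'n::finite expo \<Rightarrow> 'a::field ^ 'n"
  assumes fin: "finite {\<gamma>. h \<gamma> \<noteq> 0}"
    and closed: "\<And>\<gamma> i j. h (\<gamma> + unit_expo i) $ j = h (\<gamma> + unit_expo j) $ i"
  obtains g :: "('a, 'n) divpow" where "lookup g 0 = 0" "\<And>\<gamma>. coeff_grad g \<gamma> = h \<gamma>"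
proof -
  define s :: "'n expo \<Rightarrow> 'n" where "s \<alpha> = (SOME i. lookup \<alpha> i \<noteq> 0)" for \<alpha>
  define u where "u \<alpha> = (if \<alpha> = 0 then 0 else h (\<alpha> - unit_expo (s \<alpha>)) $ s \<alpha>)" for \<alpha>
  have u_add: "u (\<gamma> + unit_expo i) = h \<gamma> $ i" for \<gamma> i
  proof -
    let ?\<alpha> = "\<gamma> + unit_expo i" and ?k = "s (\<gamma> + unit_expo i)"
    have nz: "lookup ?\<alpha> i \<noteq> 0"
      by (simp add: lookup_add)
    then have "?\<alpha> \<noteq> 0"
      by force
    then have u_eq: "u ?\<alpha> = h (?\<alpha> - unit_expo ?k) $ ?k"
      by (simp add: u_def)
    have k: "lookup ?\<alpha> ?k \<noteq> 0"
      unfolding s_def using nz by (rule someI)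
    \<comment> \<open>If the chosen variable is not \<open>i\<close>, both variables occur in \<open>?\<alpha>\<close>, and symmetry exchanges them.\<close>
    show ?thesis
    proof (cases "?k = i")
      case True
      then show ?thesis
        by (simp add: u_eq)
    next
      case False
      define \<delta> where "\<delta> = \<gamma> - unit_expo ?k"
      have "lookup \<gamma> ?k \<noteq> 0"
        using k False by (simp add: lookup_add split: if_splits)
      then have \<gamma>: "\<gamma> = \<delta> + unit_expo ?k"
        unfolding \<delta>_def
        by (auto intro!: poly_mapping_eqI simp: lookup_add lookup_minus split: if_splits)
      have "?\<alpha> - unit_expo ?k = (\<delta> + unit_expo i) + unit_expo ?k - unit_expo ?k"
        by (subst \<gamma>) (simp only: ac_simps)
      also have "\<dots> = \<delta> + unit_expo i"
        by (rule add_diff_cancel_right')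
      finally show ?thesis
        using closed[of \<delta> i ?k] \<gamma> u_eq by metis
    qed
  qed
  have "{\<alpha>. u \<alpha> \<noteq> 0} \<subseteq> (\<Union>i. (\<lambda>\<gamma>. \<gamma> + unit_expo i) ` {\<gamma>. h \<gamma> \<noteq> 0})"
  proof
    fix \<alpha>
    assume \<alpha>: "\<alpha> \<in> {\<alpha>. u \<alpha> \<noteq> 0}"
    then have "\<alpha> \<noteq> 0"
      by (auto simp: u_def)
    then obtain \<gamma> i where "\<alpha> = \<gamma> + unit_expo i"
      by (rule expo_unit_cases)
    then show "\<alpha> \<in> (\<Union>i. (\<lambda>\<gamma>. \<gamma> + unit_expo i) ` {\<gamma>. h \<gamma> \<noteq> 0})"
      using \<alpha> u_add by force
  qed
  then have "finite {\<alpha>. u \<alpha> \<noteq> 0}"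
    by (rule finite_subset) (use fin in simp)
  then have "lookup (Abs_poly_mapping u) = u"
    by simp
  then show thesis
    using that[of "Abs_poly_mapping u"] u_add
    by (simp add: coeff_grad_def vec_eq_iff u_def)
qed


section \<open>Sums and multiples of matrices\<close>

lemma mat_scale_vector: "mat_scale c A *v v = c *s (A *v v)"
proof -
  have "(mat_scale c A *v v) $ i = (c *s (A *v v)) $ i" for i
    unfolding mat_scale_def matrix_vector_mult_def vector_smult_component vec_lambda_beta
    by (simp only: sum_distrib_left mult.assoc)
  then show ?thesis
    by (simp add: vec_eq_iff)
qed

lemma sum_matrix_vector: "(\<Sum>i\<in>I. A i) *v v = (\<Sum>i\<in>I. A i *v v)"
  by (induction I rule: infinite_finite_induct) (simp_all add: matrix_vector_mult_add_rdistrib)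

lemma sum_matrix_mult_left: "B ** (\<Sum>i\<in>I. A i) = (\<Sum>i\<in>I. B ** A i)"
  for B :: "'a::field ^ 'n ^ 'm"
  by (simp add: matrix_eq sum_matrix_vector vec.sum flip: matrix_vector_mul_assoc)

lemma sum_matrix_mult_right: "(\<Sum>i\<in>I. A i) ** B = (\<Sum>i\<in>I. A i ** B)"
  for B :: "'a::field ^ 'n ^ 'm"
  by (simp add: matrix_eq sum_matrix_vector flip: matrix_vector_mul_assoc)

lemma matrix_mult_zero [simp]: "0 ** A = 0" "A ** 0 = 0" for A :: "'a::field ^ 'n ^ 'm"
  by (simp_all add: matrix_eq flip: matrix_vector_mul_assoc)


section \<open>The matrices in \<open>M\<^sub>g\<close>\<close>

lemma subspace_ann: "idl.subspace (ann g)"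
  by (auto simp: idl.subspace_def ann_def contract_add contract_mult)

text \<open>
  The annihilator is an ideal, so it suffices to test the \<open>2 \<times> 2\<close> minors. The minor of rows \<open>i\<close>
  and \<open>j\<close> sends \<open>g\<close> to \<open>\<partial>\<^sub>i (A \<partial>g)\<^sub>j - \<partial>\<^sub>j (A \<partial>g)\<^sub>i\<close>.
\<close>

lemma Mset_iff:
  fixes g :: "('a::field, 'n::finite) divpow"
  shows "A \<in> Mset g \<longleftrightarrow>
    (\<forall>\<gamma> i j. (A *v coeff_grad g (\<gamma> + unit_expo i)) $ j = (A *v coeff_grad g (\<gamma> + unit_expo j)) $ i)"
proof -
  let ?N = "two_columns partial (mat_app A partial) :: ('a, 'n) diffop ^ 2 ^ 'n"
  let ?minor = "\<lambda>i j. det (vector [?N $ i, ?N $ j] :: ('a, 'n) diffop ^ 2 ^ 2)"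
  have A_partial: "lookup (contract (mat_app A partial $ j) g) \<delta> = (A *v coeff_grad g \<delta>) $ j" for j \<delta>
    by (simp add: mat_app_def contract_sum contract_scale lookup_sum partial_nth
        lookup_contract_single matrix_vector_mult_def coeff_grad_def)
  have minor: "?minor i j = partial $ i * mat_app A partial $ j - partial $ j * mat_app A partial $ i"
    for i j
    by (simp add: det_2 two_columns_def mult.commute)
  have "lookup (contract (?minor i j) g) \<gamma> =
      (A *v coeff_grad g (\<gamma> + unit_expo i)) $ j - (A *v coeff_grad g (\<gamma> + unit_expo j)) $ i" for i j \<gamma>
    by (simp add: minor contract_diff contract_mult lookup_minus A_partial lookup_contract_single
        partial_nth)
  then have ann: "?minor i j \<in> ann g \<longleftrightarrow> (\<forall>\<gamma>. (A *v coeff_grad g (\<gamma> + unit_expo i)) $ j =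
      (A *v coeff_grad g (\<gamma> + unit_expo j)) $ i)" for i j
    by (simp add: ann_def poly_mapping_eq_iff fun_eq_iff)
  have "A \<in> Mset g \<longleftrightarrow> (\<forall>i j. i \<noteq> j \<longrightarrow> ?minor i j \<in> ann g)"
  proof
    assume "A \<in> Mset g"
    then have "I2 ?N \<subseteq> ann g"
      by (simp add: Mset_def)
    moreover have "?minor i j \<in> I2 ?N" if "i \<noteq> j" for i j
      unfolding I2_def by (intro idl.span_base CollectI exI conjI) (rule refl, rule that)
    ultimately show "\<forall>i j. i \<noteq> j \<longrightarrow> ?minor i j \<in> ann g"
      by blast
  next
    assume "\<forall>i j. i \<noteq> j \<longrightarrow> ?minor i j \<in> ann g"
    then have "I2 ?N \<subseteq> ann g"
      unfolding I2_def by (intro idl.span_minimal subspace_ann) blast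
    then show "A \<in> Mset g"
      by (simp add: Mset_def)
  qed
  then show ?thesis
    unfolding ann by metis
qed

lemma gam_eqI:
  assumes "d > 0" "g \<in> homog d" "\<And>\<gamma>. coeff_grad g \<gamma> = A *v coeff_grad f \<gamma>"
  shows "gam d f A = g"
  unfolding gam_def grad_eq_mat_app_iff
  using assms by (intro the_equality) (auto intro!: homog_eqI[of _ d])

text \<open>
  The condition \<open>Mset_iff\<close> is the integrability condition for \<open>A \<partial>f\<close>. The potential is homogeneous
  once its constant term is chosen to be zero.
\<close>

lemma gam_props:
  fixes f :: "('a::field, 'n::finite) divpow"
  assumes "d > 0" "f \<in> homog d" "A \<in> Mset f"
  shows "gam d f A \<in> homog d" "coeff_grad (gam d f A) \<gamma> = A *v coeff_grad f \<gamma>"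
proof -
  have "{\<gamma>. coeff_grad f \<gamma> \<noteq> 0} \<subseteq> (\<Union>i. (\<lambda>\<alpha>. \<alpha> - unit_expo i) ` keys f)"
  proof
    fix \<gamma>
    assume "\<gamma> \<in> {\<gamma>. coeff_grad f \<gamma> \<noteq> 0}"
    then obtain i where "\<gamma> + unit_expo i \<in> keys f"
      by (auto simp: coeff_grad_def vec_eq_iff in_keys_iff)
    moreover have "\<gamma> = (\<gamma> + unit_expo i) - unit_expo i"
      by simp
    ultimately show "\<gamma> \<in> (\<Union>i. (\<lambda>\<alpha>. \<alpha> - unit_expo i) ` keys f)"
      by blast
  qed
  then have "finite {\<gamma>. coeff_grad f \<gamma> \<noteq> 0}"
    by (rule finite_subset) simp
  then have "finite {\<gamma>. A *v coeff_grad f \<gamma> \<noteq> 0}"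
    by (rule finite_subset[rotated]) auto
  then obtain g :: "('a, 'n) divpow" where g0: "lookup g 0 = 0"
    and g: "\<And>\<gamma>. coeff_grad g \<gamma> = A *v coeff_grad f \<gamma>"
    using ex_coeff_grad[of "\<lambda>\<gamma>. A *v coeff_grad f \<gamma>" thesis] assms(3)[unfolded Mset_iff] by blast
  have "g \<in> homog d"
    unfolding homog_lookup
  proof (intro allI impI)
    fix \<alpha>
    assume nz: "lookup g \<alpha> \<noteq> 0"
    with g0 have "\<alpha> \<noteq> 0"
      by auto
    then obtain \<beta> i where \<alpha>: "\<alpha> = \<beta> + unit_expo i"
      by (rule expo_unit_cases)
    then have "coeff_grad g \<beta> \<noteq> 0"
      using nz by (auto simp: coeff_grad_def vec_eq_iff)
    then have "coeff_grad f \<beta> \<noteq> 0"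
      by (auto simp: g)
    then show "expo_deg \<alpha> = d"
      using coeff_grad_degree[OF assms(2)] by (simp add: \<alpha> expo_deg_add)
  qed
  then have "gam d f A = g"
    using gam_eqI[OF assms(1)] g by blast
  then show "gam d f A \<in> homog d" "coeff_grad (gam d f A) \<gamma> = A *v coeff_grad f \<gamma>"
    using g \<open>g \<in> homog d\<close> by auto
qed

text \<open>
  Membership depends only on the vectors \<open>A \<partial>f\<close>. This compares matrices that agree on the
  gradient of one form, and also a form with its summand \<open>gam d f A\<close>.
\<close>

lemma Mset_transfer:
  assumes "\<And>\<gamma>. A *v coeff_grad f \<gamma> = B *v coeff_grad g \<gamma>"
  shows "A \<in> Mset f \<longleftrightarrow> B \<in> Mset g"
  by (simp add: Mset_iff assms)

lemma subspace_Mset: "matv.subspace (Mset g)"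
  unfolding matv.subspace_def
  by (simp add: Mset_iff mat_scale_vector matrix_vector_mult_add_rdistrib)

text \<open>
  Two symmetries are combined: component \<open>j\<close> of the left-hand side equals component \<open>i\<close> of
  \<open>A *v coeff_grad f (\<gamma> + unit_expo j)\<close>, where row \<open>i\<close> of \<open>A\<close> enters, and then the index \<open>j\<close>
  is exchanged with the summation index.
\<close>

lemma Mset_apply:
  assumes "A \<in> Mset f"
  shows "A *v coeff_grad f (\<gamma> + unit_expo i) = (\<Sum>k\<in>UNIV. A $ i $ k *s coeff_grad f (\<gamma> + unit_expo k))"
proof -
  have "(A *v coeff_grad f (\<gamma> + unit_expo i)) $ j =
      (\<Sum>k\<in>UNIV. A $ i $ k *s coeff_grad f (\<gamma> + unit_expo k)) $ j" for j
  proof -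
    have "(A *v coeff_grad f (\<gamma> + unit_expo i)) $ j = (A *v coeff_grad f (\<gamma> + unit_expo j)) $ i"
      using assms by (simp add: Mset_iff)
    also have "\<dots> = (\<Sum>k\<in>UNIV. A $ i $ k * coeff_grad f (\<gamma> + unit_expo k) $ j)"
      by (simp add: matrix_vector_mult_def coeff_grad_swap[of f \<gamma> j])
    finally show ?thesis
      by simp
  qed
  then show ?thesis
    by (simp add: vec_eq_iff)
qed


section \<open>The span of the gradient\<close>

definition grad_space :: "('a::field, 'n::finite) divpow \<Rightarrow> ('a ^ 'n) set"
  where "grad_space g = vec.span (range (coeff_grad g))"

lemma coeff_grad_in_grad_space [simp]: "coeff_grad g \<gamma> \<in> grad_space g"
  by (simp add: grad_space_def vec.span_base)

lemma subspace_grad_space [simp]: "vec.subspace (grad_space g)"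
  by (simp add: grad_space_def)

lemma eq_on_grad_space:
  assumes "\<And>\<gamma>. A *v coeff_grad f \<gamma> = B *v coeff_grad f \<gamma>" "w \<in> grad_space f"
  shows "A *v w = B *v w"
  by (rule vec.linear_eq_on_span[of "(*v) A" "(*v) B" "range (coeff_grad f)"])
    (use assms in \<open>auto simp: grad_space_def\<close>)

lemma grad_space_image:
  assumes "\<And>\<gamma>. coeff_grad g \<gamma> = A *v coeff_grad f \<gamma>"
  shows "grad_space g = (*v) A ` grad_space f"
proof -
  have "range (coeff_grad g) = (*v) A ` range (coeff_grad f)"
    by (simp add: assms image_image)
  then show ?thesis
    by (simp add: grad_space_def vec.span_image)
qed

text \<open>
  A nonzero vector \<open>coeff_grad f \<gamma>\<close> has \<open>\<gamma>\<close> of degree \<open>d - 1 \<ge> 1\<close>, so \<open>Mset_apply\<close> applies to it.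
\<close>

lemma Mset_grad_space:
  assumes d: "d \<ge> 2" and f: "f \<in> homog d" and A: "A \<in> Mset f" and w: "w \<in> grad_space f"
  shows "A *v w \<in> grad_space f"
proof -
  have gen: "A *v coeff_grad f \<gamma> \<in> grad_space f" for \<gamma>
  proof (cases "coeff_grad f \<gamma> = 0")
    case True
    then show ?thesis
      by (simp add: vec.subspace_0)
  next
    case False
    then have "\<gamma> \<noteq> 0"
      using coeff_grad_degree[OF f] d expo_deg_zero_iff[of \<gamma>] by fastforce
    then obtain \<delta> i where "\<gamma> = \<delta> + unit_expo i"
      by (rule expo_unit_cases)
    then show ?thesis
      by (simp add: Mset_apply[OF A] vec.subspace_sum vec.subspace_scale)
  qed
  have "(*v) A ` grad_space f = vec.span ((*v) A ` range (coeff_grad f))"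
    by (simp add: grad_space_def vec.span_image)
  also have "\<dots> \<subseteq> grad_space f"
    by (rule vec.span_minimal) (use gen in auto)
  finally show ?thesis
    using w by blast
qed

text \<open>
  A nonzero vector \<open>coeff_grad f \<gamma>\<close> has \<open>\<gamma>\<close> of degree \<open>d - 1 \<ge> 2\<close>, so
  \<open>\<gamma> = \<delta> + e\<^sub>j + e\<^sub>i\<close>. By \<open>Mset_apply\<close>, one matrix acts on the index \<open>i\<close> and the other one on
  \<open>j\<close>, and the order of these two actions is immaterial.
\<close>

lemma Mset_commute:
  assumes d: "d \<ge> 3" and f: "f \<in> homog d" and A: "A \<in> Mset f" and B: "B \<in> Mset f"
    and w: "w \<in> grad_space f"
  shows "A *v (B *v w) = B *v (A *v w)"
proof -
  have "(A ** B) *v coeff_grad f \<gamma> = (B ** A) *v coeff_grad f \<gamma>" for \<gamma>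
  proof (cases "coeff_grad f \<gamma> = 0")
    case False
    then have deg: "expo_deg \<gamma> \<ge> 2"
      using coeff_grad_degree[OF f] d by fastforce
    then have "\<gamma> \<noteq> 0"
      using expo_deg_zero_iff[of \<gamma>] by auto
    then obtain \<gamma>' i where \<gamma>': "\<gamma> = \<gamma>' + unit_expo i"
      by (rule expo_unit_cases)
    then have "\<gamma>' \<noteq> 0"
      using deg expo_deg_zero_iff[of \<gamma>'] by (auto simp: expo_deg_add)
    then obtain \<delta> j where "\<gamma>' = \<delta> + unit_expo j"
      by (rule expo_unit_cases)
    then have \<gamma>: "\<gamma> = \<delta> + unit_expo j + unit_expo i"
      using \<gamma>' by simp
    have two: "P *v (Q *v coeff_grad f (\<delta> + unit_expo p + unit_expo q)) =
        (\<Sum>k\<in>UNIV. \<Sum>l\<in>UNIV. (Q $ q $ k * P $ p $ l) *s coeff_grad f (\<delta> + unit_expo k + unit_expo l))"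
      if "P \<in> Mset f" "Q \<in> Mset f" for P Q p q
    proof -
      have "P *v (Q *v coeff_grad f (\<delta> + unit_expo p + unit_expo q)) =
          (\<Sum>k\<in>UNIV. Q $ q $ k *s (P *v coeff_grad f (\<delta> + unit_expo p + unit_expo k)))"
        by (simp add: Mset_apply[OF that(2)] vec.sum vec.scale)
      also have "\<dots> = (\<Sum>k\<in>UNIV. Q $ q $ k *s (P *v coeff_grad f (\<delta> + unit_expo k + unit_expo p)))"
        by (simp add: ac_simps)
      also have "\<dots> = (\<Sum>k\<in>UNIV. \<Sum>l\<in>UNIV.
          (Q $ q $ k * P $ p $ l) *s coeff_grad f (\<delta> + unit_expo k + unit_expo l))"
        by (simp add: Mset_apply[OF that(1)] vec.scale_sum_right)
      finally show ?thesis .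
    qed
    have "A *v (B *v coeff_grad f \<gamma>) =
        (\<Sum>k\<in>UNIV. \<Sum>l\<in>UNIV. (B $ i $ k * A $ j $ l) *s coeff_grad f (\<delta> + unit_expo k + unit_expo l))"
      unfolding \<gamma> by (rule two[OF A B])
    also have "\<dots> = (\<Sum>l\<in>UNIV. \<Sum>k\<in>UNIV.
        (A $ j $ l * B $ i $ k) *s coeff_grad f (\<delta> + unit_expo l + unit_expo k))"
      by (subst sum.swap) (simp add: ac_simps)
    also have "\<dots> = B *v (A *v coeff_grad f (\<delta> + unit_expo i + unit_expo j))"
      by (rule two[OF B A, symmetric])
    also have "\<delta> + unit_expo i + unit_expo j = \<gamma>"
      by (simp add: \<gamma> ac_simps)
    finally show ?thesis
      by (simp add: matrix_vector_mul_assoc)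
  qed simp
  from eq_on_grad_space[OF this w] show ?thesis
    by (simp add: matrix_vector_mul_assoc)
qed

text \<open>
  Pulling \<open>B\<close> through with \<open>Mset_apply\<close> and using the symmetry for \<open>A\<close> exchanges the free
  indices but turns \<open>A B\<close> into \<open>B A\<close>; commutativity on the span of the gradient repairs this.
\<close>

lemma Mset_mult:
  assumes d: "d \<ge> 3" and f: "f \<in> homog d" and A: "A \<in> Mset f" and B: "B \<in> Mset f"
  shows "A ** B \<in> Mset f"
  unfolding Mset_iff
proof (intro allI)
  fix \<gamma> i j
  let ?h = "\<lambda>k. coeff_grad f (\<gamma> + unit_expo k)"
  have "((A ** B) *v ?h i) $ j = (\<Sum>k\<in>UNIV. B $ i $ k * (A *v ?h k) $ j)"
    by (simp add: Mset_apply[OF B] vec.sum vec.scale flip: matrix_vector_mul_assoc)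
  also have "\<dots> = (\<Sum>k\<in>UNIV. B $ i $ k * (A *v ?h j) $ k)"
    using A by (simp add: Mset_iff)
  also have "\<dots> = (B *v (A *v ?h j)) $ i"
    by (simp add: matrix_vector_mult_def)
  also have "\<dots> = ((A ** B) *v ?h j) $ i"
    by (simp add: Mset_commute[OF d f A B] flip: matrix_vector_mul_assoc)
  finally show "((A ** B) *v ?h i) $ j = ((A ** B) *v ?h j) $ i" .
qed


section \<open>Derivatives of order \<open>d - 1\<close> as linear forms\<close>

definition linear_form :: "'a::field ^ 'n \<Rightarrow> ('a, 'n::finite) divpow"
  where "linear_form v = (\<Sum>i\<in>UNIV. Poly_Mapping.single (unit_expo i) (v $ i))"

lemma unit_expo_eq_iff [simp]: "unit_expo i = unit_expo j \<longleftrightarrow> i = j"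
  by (metis lookup_unit_expo zero_neq_one)

lemma lookup_linear_form_unit [simp]: "lookup (linear_form v) (unit_expo i) = v $ i"
  by (simp add: linear_form_def lookup_sum lookup_single when_def)

lemma lookup_linear_form_other: "expo_deg \<alpha> \<noteq> 1 \<Longrightarrow> lookup (linear_form v) \<alpha> = 0"
  by (auto simp: linear_form_def lookup_sum lookup_single when_def intro!: sum.neutral)

lemma expo_deg_one_cases:
  assumes "expo_deg \<alpha> = 1"
  obtains i where "\<alpha> = unit_expo i"
proof -
  have "\<alpha> \<noteq> 0"
    using assms expo_deg_zero_iff[of \<alpha>] by auto
  then obtain \<gamma> i where "\<alpha> = \<gamma> + unit_expo i"
    by (rule expo_unit_cases)
  moreover from this assms have "\<gamma> = 0"
    by (simp add: expo_deg_add expo_deg_zero_iff)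
  ultimately show thesis
    using that by simp
qed

lemma eq_linear_formI:
  assumes "p \<in> homog 1" "\<And>i. lookup p (unit_expo i) = v $ i"
  shows "p = linear_form v"
proof (rule poly_mapping_eqI)
  fix \<alpha>
  show "lookup p \<alpha> = lookup (linear_form v) \<alpha>"
  proof (cases "expo_deg \<alpha> = 1")
    case True
    then show ?thesis
      by (elim expo_deg_one_cases) (simp add: assms)
  next
    case False
    then show ?thesis
      using assms(1) by (metis homog_lookup lookup_linear_form_other)
  qed
qed

lemma linear_form_homog: "linear_form v \<in> homog 1"
  by (metis homog_lookup lookup_linear_form_other)

lemma inj_linear_form: "inj linear_form"
  by (rule injI) (metis lookup_linear_form_unit vec_eq_iff)

lemma linear_linear_form: "Vector_Spaces.linear (*s) pm_scale linear_form"
proof -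
  have "linear_form (v + w) = linear_form v + linear_form w" for v w :: "'a ^ 'n"
    by (simp add: linear_form_def single_add sum.distrib)
  moreover have "linear_form (c *s v) = pm_scale c (linear_form v)" for c and v :: "'a ^ 'n"
    by (rule eq_linear_formI[symmetric])
      (use linear_form_homog[of v] in \<open>auto simp: homog_lookup\<close>)
  ultimately show ?thesis
    by unfold_locales
qed

interpretation linear_form: Vector_Spaces.linear "(*s)" pm_scale linear_form
  by (rule linear_linear_form)

lemma subspace_homog: "pm.subspace (homog d :: ('n::finite expo \<Rightarrow>\<^sub>0 'a::field) set)"
proof (rule pm.subspaceI)
  fix p q :: "'n expo \<Rightarrow>\<^sub>0 'a"
  assume "p \<in> homog d" "q \<in> homog d"
  then show "p + q \<in> homog d"
    unfolding homog_lookup lookup_add by (metis add.right_neutral)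
qed (auto simp: homog_lookup)

lemma subspace_derivs: "pm.subspace (derivs e g)"
proof (rule pm.subspaceI)
  show "0 \<in> derivs e g"
    using pm.subspace_0[OF subspace_homog] contract_zero_left[of g]
    unfolding derivs_def by (metis (mono_tags, lifting) mem_Collect_eq)
next
  fix p q
  assume "p \<in> derivs e g" "q \<in> derivs e g"
  then show "p + q \<in> derivs e g"
    unfolding derivs_def using pm.subspace_add[OF subspace_homog]
    by (force simp flip: contract_add)
next
  fix c p
  assume "p \<in> derivs e g"
  then show "pm_scale c p \<in> derivs e g"
    unfolding derivs_def using pm.subspace_scale[OF subspace_homog]
    by (force simp flip: contract_scale)
qed

text \<open>
  The \<open>i\<close>-th coefficient of \<open>D g\<close> is the \<open>i\<close>-th entry of the combination of the vectors
  \<open>coeff_grad g \<beta>\<close> with the coefficients of \<open>D\<close>. Homogeneity of \<open>g\<close> kills all vectors but those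
  with \<open>\<beta>\<close> of degree \<open>d - 1\<close>, so restricting to operators \<open>D\<close> of that degree loses nothing.
\<close>

lemma derivs_eq_linear_form:
  assumes g: "g \<in> homog d" and d: "d > 0"
  shows "derivs (d - 1) g = linear_form ` grad_space g"
proof (intro equalityI subsetI)
  fix p
  assume "p \<in> derivs (d - 1) g"
  then obtain D where D: "D \<in> homog (d - 1)" and p: "p = contract D g"
    by (auto simp: derivs_def)
  define v where "v = (\<Sum>\<beta>\<in>keys D. lookup D \<beta> *s coeff_grad g \<beta>)"
  have "p \<in> homog 1"
    unfolding homog_lookup
  proof (intro allI impI)
    fix \<alpha>
    assume "lookup p \<alpha> \<noteq> 0"
    then obtain \<beta> where "lookup D \<beta> \<noteq> 0" "lookup g (\<alpha> + \<beta>) \<noteq> 0"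
      unfolding p lookup_contract by (metis (no_types, lifting) mult_eq_0_iff sum.neutral)
    then have "expo_deg \<beta> = d - 1" "expo_deg (\<alpha> + \<beta>) = d"
      using D g by (auto simp: homog_lookup)
    then show "expo_deg \<alpha> = 1"
      using d by (simp add: expo_deg_add)
  qed
  moreover have "lookup p (unit_expo i) = v $ i" for i
    by (simp add: p lookup_contract v_def coeff_grad_def add.commute)
  ultimately have "p = linear_form v"
    by (rule eq_linear_formI)
  moreover have "v \<in> grad_space g"
    unfolding v_def by (intro vec.subspace_sum vec.subspace_scale) simp_all
  ultimately show "p \<in> linear_form ` grad_space g"
    by blast
next
  let ?S = "{v. linear_form v \<in> derivs (d - 1) g}"
  have "vec.subspace ?S"
    using subspace_derivs[of "d - 1" g]
    by (simp add: vec.subspace_def pm.subspace_def linear_form.zero linear_form.add linear_form.scale)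
  moreover have "coeff_grad g \<gamma> \<in> ?S" for \<gamma>
  proof (cases "coeff_grad g \<gamma> = 0")
    case True
    then show ?thesis
      using \<open>vec.subspace ?S\<close> by (metis vec.subspace_0)
  next
    case False
    have "contract (Poly_Mapping.single \<gamma> 1) g \<in> homog 1"
      using coeff_grad_degree[OF g False] g
      by (auto simp: homog_lookup lookup_contract_single expo_deg_add)
    then have "contract (Poly_Mapping.single \<gamma> 1) g = linear_form (coeff_grad g \<gamma>)"
      by (rule eq_linear_formI) (simp add: lookup_contract_single coeff_grad_def add.commute)
    moreover have "Poly_Mapping.single \<gamma> 1 \<in> homog (d - 1)"
      using coeff_grad_degree[OF g False] by (auto simp: homog_def)
    ultimately show ?thesis
      unfolding derivs_def by force
  qed
  ultimately have "grad_space g \<subseteq> ?S"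
    unfolding grad_space_def by (intro vec.span_minimal) auto
  then show "p \<in> derivs (d - 1) g" if "p \<in> linear_form ` grad_space g" for p
    using that by blast
qed

lemma dim_derivs:
  fixes g :: "('a::field, 'n::finite) divpow"
  assumes "g \<in> homog d" "d > 0"
  shows "pm.dim (derivs (d - 1) g) = vec.dim (grad_space g)"
proof -
  interpret finite_dimensional_vector_space_pair_1 "(*s) :: 'a \<Rightarrow> 'a ^ 'n \<Rightarrow> 'a ^ 'n" cart_basis
    "pm_scale :: 'a \<Rightarrow> ('a, 'n) divpow \<Rightarrow> ('a, 'n) divpow" ..
  show ?thesis
    unfolding derivs_eq_linear_form[OF assms]
    by (rule dim_image_eq[OF linear_linear_form]) (rule inj_on_subset[OF inj_linear_form subset_UNIV])
qed


section \<open>Rank, projections and sums of subspaces\<close>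

text \<open>
  \<open>rank\<close> is the row rank. Writing the rows in terms of a basis \<open>B\<close> of the row space factors \<open>A\<close>
  through \<open>K\<close> to the power \<open>card B\<close>, which bounds the dimension of the image over every field.
\<close>

lemma dim_range_le_rank:
  fixes A :: "'a::field ^ 'n ^ 'm"
  shows "vec.dim (range ((*v) A)) \<le> rank A"
proof -
  obtain B where B: "B \<subseteq> rows A" "vec.independent B" "rows A \<subseteq> vec.span B" "card B = vec.dim (rows A)"
    by (rule vec.basis_exists)
  have fin: "finite B"
    using B(2) by (rule vec.finiteI_independent)
  have "\<forall>i. \<exists>c. row i A = (\<Sum>b\<in>B. c b *s b)"
    using B(3) vec.span_finite[OF fin] by (auto simp: rows_def image_iff subset_iff)
  then obtain c where c: "\<And>i. row i A = (\<Sum>b\<in>B. c i b *s b)"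
    by metis
  define col where "col b = (\<chi> i. c i b)" for b
  have "A *v v = (\<Sum>b\<in>B. (\<Sum>k\<in>UNIV. b $ k * v $ k) *s col b)" for v
  proof -
    have "(A *v v) $ i = (\<Sum>b\<in>B. (\<Sum>k\<in>UNIV. b $ k * v $ k) *s col b) $ i" for i
    proof -
      have "A $ i $ k = (\<Sum>b\<in>B. c i b * b $ k)" for k
        using c[of i] by (simp add: row_def vec_eq_iff)
      then have "(A *v v) $ i = (\<Sum>k\<in>UNIV. (\<Sum>b\<in>B. c i b * b $ k) * v $ k)"
        by (simp add: matrix_vector_mult_def)
      also have "\<dots> = (\<Sum>k\<in>UNIV. \<Sum>b\<in>B. b $ k * v $ k * c i b)"
        by (simp only: sum_distrib_right) (simp only: ac_simps)
      also have "\<dots> = (\<Sum>b\<in>B. \<Sum>k\<in>UNIV. b $ k * v $ k * c i b)"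
        by (rule sum.swap)
      also have "\<dots> = (\<Sum>b\<in>B. (\<Sum>k\<in>UNIV. b $ k * v $ k) * c i b)"
        by (simp only: sum_distrib_right)
      finally show ?thesis
        by (simp add: col_def)
    qed
    then show ?thesis
      by (simp add: vec_eq_iff)
  qed
  then have "A *v v \<in> vec.span (col ` B)" for v
    by (metis (no_types, lifting) imageI vec.span_base vec.span_scale vec.span_sum)
  then have "vec.dim (range ((*v) A)) \<le> card (col ` B)"
    by (intro vec.dim_le_card) (auto simp: fin)
  also have "\<dots> \<le> card B"
    by (rule card_image_le[OF fin])
  finally show ?thesis
    by (simp add: B(4) row_rank_def_gen)
qed

text \<open>
  If \<open>p\<close> is a projection onto \<open>U\<close>, then \<open>x - p x\<close> vanishes on \<open>U\<close> and is injective on \<open>V\<close>; a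
  linear left inverse on \<open>V\<close> turns it into the required map.
\<close>

lemma ex_projection:
  fixes V U :: "('a::field ^ 'n) set"
  assumes V: "vec.subspace V" and U: "vec.subspace U" and disj: "V \<inter> U = {0}"
  obtains P :: "'a ^ 'n ^ 'n" where "\<And>v. v \<in> V \<Longrightarrow> P *v v = v" "\<And>u. u \<in> U \<Longrightarrow> P *v u = 0"
proof -
  obtain p :: "'a ^ 'n \<Rightarrow> 'a ^ 'n" where p: "range p \<subseteq> U" "Vector_Spaces.linear (*s) (*s) p"
    "\<And>u. u \<in> U \<Longrightarrow> p u = u"
    using vec.linear_exists_left_inverse_on[OF vec.linear_ident U] by auto
  define Q where "Q = mat 1 - matrix p"
  have Q: "Q *v x = x - p x" for x
    by (simp add: Q_def matrix_vector_mult_diff_rdistrib matrix_works[OF p(2)])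
  have "inj_on ((*v) Q) V"
  proof (rule inj_onI)
    fix v w
    assume vw: "v \<in> V" "w \<in> V" "Q *v v = Q *v w"
    then have "v - w = p v - p w"
      by (simp add: Q algebra_simps)
    then have "v - w \<in> U"
      using p(1) U by (metis rangeI subsetD vec.subspace_diff)
    then have "v - w \<in> V \<inter> U"
      using vw V by (simp add: vec.subspace_diff)
    then show "v = w"
      using disj by simp
  qed
  then obtain h :: "'a ^ 'n \<Rightarrow> 'a ^ 'n" where h: "Vector_Spaces.linear (*s) (*s) h"
    "\<And>v. v \<in> V \<Longrightarrow> h (Q *v v) = v"
    using vec.linear_exists_left_inverse_on[OF matrix_vector_mul_linear_gen V] by metis
  show thesis
  proof (rule that[of "matrix h ** Q"])
    show "(matrix h ** Q) *v v = v" if "v \<in> V" for v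
      using h(2)[OF that] by (simp add: matrix_works[OF h(1)] flip: matrix_vector_mul_assoc)
    show "(matrix h ** Q) *v u = 0" if "u \<in> U" for u
      using that by (simp add: Q p(3) flip: matrix_vector_mul_assoc)
  qed
qed

lemma subspace_sum_cong:
  "(\<And>j. j \<in> J \<Longrightarrow> V j = W j) \<Longrightarrow> subspace_sum J V = subspace_sum J W"
  by (simp add: subspace_sum_def)

lemma subspace_subspace_sum:
  assumes "\<And>j. j \<in> J \<Longrightarrow> vec.subspace (V j)"
  shows "vec.subspace (subspace_sum J V)"
proof (rule vec.subspaceI)
  show "0 \<in> subspace_sum J V"
    unfolding subspace_sum_def using assms vec.subspace_0 by (force intro!: exI[of _ "\<lambda>_. 0"])
next
  fix x y
  assume "x \<in> subspace_sum J V" "y \<in> subspace_sum J V"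
  then obtain v w where "x = sum v J" "y = sum w J" "\<forall>j\<in>J. v j \<in> V j" "\<forall>j\<in>J. w j \<in> V j"
    by (auto simp: subspace_sum_def)
  then show "x + y \<in> subspace_sum J V"
    unfolding subspace_sum_def using assms
    by (auto simp: sum.distrib vec.subspace_add intro!: exI[of _ "\<lambda>j. v j + w j"])
next
  fix c x
  assume "x \<in> subspace_sum J V"
  then obtain v where "x = sum v J" "\<forall>j\<in>J. v j \<in> V j"
    by (auto simp: subspace_sum_def)
  then show "c *s x \<in> subspace_sum J V"
    unfolding subspace_sum_def using assms
    by (auto simp: vec.scale_sum_right vec.subspace_scale intro!: exI[of _ "\<lambda>j. c *s v j"])
qed

lemma subset_subspace_sum:
  assumes "finite J" "j \<in> J" "\<And>k. k \<in> J \<Longrightarrow> vec.subspace (V k)" "x \<in> V j"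
  shows "x \<in> subspace_sum J V"
proof -
  have "x = (\<Sum>k\<in>J. if k = j then x else 0)"
    using assms(1,2) by simp
  moreover have "\<forall>k\<in>J. (if k = j then x else 0) \<in> V k"
    using assms vec.subspace_0 by auto
  ultimately show ?thesis
    unfolding subspace_sum_def by (intro CollectI exI[of _ "\<lambda>k. if k = j then x else 0"] conjI)
qed

lemma subspace_sum_linear_form:
  "subspace_sum J (\<lambda>j. linear_form ` V j) = linear_form ` subspace_sum J V"
proof (intro equalityI subsetI)
  fix p
  assume "p \<in> subspace_sum J (\<lambda>j. linear_form ` V j)"
  then obtain q where q: "p = sum q J" "\<forall>j\<in>J. q j \<in> linear_form ` V j"
    by (auto simp: subspace_sum_def)
  then have "\<forall>j\<in>J. \<exists>v. v \<in> V j \<and> q j = linear_form v"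
    by auto
  then obtain v where v: "\<forall>j\<in>J. v j \<in> V j \<and> q j = linear_form (v j)"
    by metis
  then have "p = linear_form (sum v J)"
    by (simp add: q(1) linear_form.sum)
  then show "p \<in> linear_form ` subspace_sum J V"
    using v by (auto simp: subspace_sum_def)
next
  fix p
  assume "p \<in> linear_form ` subspace_sum J V"
  then obtain v where "p = linear_form (sum v J)" "\<forall>j\<in>J. v j \<in> V j"
    by (auto simp: subspace_sum_def)
  then show "p \<in> subspace_sum J (\<lambda>j. linear_form ` V j)"
    by (auto simp: subspace_sum_def linear_form.sum intro!: exI[of _ "\<lambda>j. linear_form (v j)"])
qed

text \<open>
  Regularity is a condition on spaces of linear forms, so it can be tested on the spaces of their
  coefficient vectors.
\<close>

lemma regular_splitting_iff:
  assumes d: "d > 0"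
  shows "regular_splitting d f n g \<longleftrightarrow>
    f = (\<Sum>i\<in>{1..n}. g i) \<and> (\<forall>i\<in>{1..n}. g i \<noteq> 0 \<and> g i \<in> homog d) \<and>
    (\<forall>i\<in>{1..n}. grad_space (g i) \<inter> subspace_sum ({1..n} - {i}) (\<lambda>j. grad_space (g j)) = {0})"
proof -
  have "derivs (d - 1) (g i) \<inter> subspace_sum ({1..n} - {i}) (\<lambda>j. derivs (d - 1) (g j)) = {0} \<longleftrightarrow>
      grad_space (g i) \<inter> subspace_sum ({1..n} - {i}) (\<lambda>j. grad_space (g j)) = {0}" (is "?L = {0} \<longleftrightarrow> ?R = {0}")
    if homog: "\<forall>i\<in>{1..n}. g i \<in> homog d" and i: "i \<in> {1..n}" for i
  proof -
    have derivs: "derivs (d - 1) (g j) = linear_form ` grad_space (g j)" if "j \<in> {1..n}" for j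
      using homog that d by (intro derivs_eq_linear_form) auto
    then have "subspace_sum ({1..n} - {i}) (\<lambda>j. derivs (d - 1) (g j)) =
        subspace_sum ({1..n} - {i}) (\<lambda>j. linear_form ` grad_space (g j))"
      by (intro subspace_sum_cong) blast
    then have "?L = linear_form ` ?R"
      unfolding derivs[OF i] subspace_sum_linear_form image_Int[OF inj_linear_form] by simp
    then have "?L = {0} \<longleftrightarrow> linear_form ` ?R = linear_form ` {0}"
      by (simp add: linear_form.zero)
    also have "\<dots> \<longleftrightarrow> ?R = {0}"
      by (rule inj_image_eq_iff[OF inj_linear_form])
    finally show ?thesis .
  qed
  then show ?thesis
    unfolding regular_splitting_def by (intro conj_cong refl ball_cong) auto
qed


section \<open>The algebra \<open>M\<^sub>f\<^sup>E\<close> of a projection onto the span of the gradient\<close>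

text \<open>
  The rank condition enters only through the consequence that the image of \<open>E\<close> lies in the span
  of the gradient. In this form the assumptions pass from \<open>f\<close> and \<open>E\<close> to the summands of a
  splitting and their idempotents (\<open>grad_projection_summand\<close>).
\<close>

locale grad_projection =
  fixes d :: nat and f :: "('a::field, 'n::finite) divpow" and E :: "'a ^ 'n ^ 'n"
  assumes degree: "d \<ge> 2" and homog: "f \<in> homog d"
    and fixes_grad_space: "w \<in> grad_space f \<Longrightarrow> E *v w = w"
    and range_grad_space: "E *v v \<in> grad_space f"
begin

lemma E_coeff_grad [simp]: "E *v coeff_grad f \<gamma> = coeff_grad f \<gamma>"
  by (simp add: fixes_grad_space)

lemma E_in_Mset: "E \<in> Mset f"
  by (simp add: Mset_iff coeff_grad_swap)

lemma E_idempotent: "E ** E = E"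
  by (simp add: matrix_eq fixes_grad_space range_grad_space flip: matrix_vector_mul_assoc)

text \<open>
  Multiplication by \<open>E\<close> from the left changes nothing, since the elements of \<open>M\<^sub>f\<close> map
  \<open>grad_space f\<close> into itself.
\<close>

lemma MsetE_iff: "A \<in> MsetE f E \<longleftrightarrow> A \<in> Mset f \<and> A ** E = A"
proof
  assume "A \<in> MsetE f E"
  then obtain B where "A \<in> Mset f" "A = E ** B ** E"
    by (auto simp: MsetE_def)
  then show "A \<in> Mset f \<and> A ** E = A"
    by (simp add: E_idempotent flip: matrix_mul_assoc)
next
  assume A: "A \<in> Mset f \<and> A ** E = A"
  then have "E *v (A *v (E *v v)) = A *v (E *v v)" for v
    by (intro fixes_grad_space Mset_grad_space[OF degree homog] range_grad_space) simp
  then have "E ** A ** E = A ** E"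
    by (simp add: matrix_eq flip: matrix_vector_mul_assoc)
  then show "A \<in> MsetE f E"
    using A unfolding MsetE_def by (metis (mono_tags, lifting) IntI mem_Collect_eq)
qed

lemma MsetE_absorb:
  assumes "A \<in> MsetE f E"
  shows "A ** E = A" "E ** A = A"
proof -
  obtain B where "A = E ** B ** E"
    using assms by (auto simp: MsetE_def)
  then show "A ** E = A" "E ** A = A"
    by (simp_all add: E_idempotent matrix_mul_assoc) (simp add: E_idempotent flip: matrix_mul_assoc)
qed

lemma MsetE_eq: "MsetE f E = {A ** E | A. A \<in> Mset f}"
proof -
  have "A ** E \<in> MsetE f E" if "A \<in> Mset f" for A
  proof -
    have "A ** E \<in> Mset f"
      using that Mset_transfer[of "A ** E" f A f] by (simp flip: matrix_vector_mul_assoc)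
    then show ?thesis
      by (simp add: MsetE_iff E_idempotent flip: matrix_mul_assoc)
  qed
  then show ?thesis
    by (auto simp: MsetE_iff) metis
qed

lemma E_in_MsetE: "E \<in> MsetE f E"
  by (simp add: MsetE_iff E_in_Mset E_idempotent)

lemma MsetE_eqI:
  assumes "A \<in> MsetE f E" "B \<in> MsetE f E" "\<And>\<gamma>. A *v coeff_grad f \<gamma> = B *v coeff_grad f \<gamma>"
  shows "A = B"
proof -
  have "A *v (E *v v) = B *v (E *v v)" for v
    by (rule eq_on_grad_space[OF assms(3) range_grad_space])
  then have "A ** E = B ** E"
    by (simp add: matrix_eq flip: matrix_vector_mul_assoc)
  then show ?thesis
    using assms(1,2) by (simp add: MsetE_absorb)
qed

lemma subspace_MsetE: "matv.subspace (MsetE f E)"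
proof -
  have "mat_scale c A ** E = mat_scale c (A ** E)" "(A + B) ** E = A ** E + B ** E"
    for c and A B :: "'a ^ 'n ^ 'n"
    by (simp_all add: matrix_eq mat_scale_vector matrix_vector_mult_add_rdistrib
        flip: matrix_vector_mul_assoc)
  moreover have "A \<in> Mset f \<Longrightarrow> B \<in> Mset f \<Longrightarrow> A + B \<in> Mset f"
    "A \<in> Mset f \<Longrightarrow> mat_scale c A \<in> Mset f" "0 \<in> Mset f" for c A B
    using subspace_Mset[of f] unfolding matv.subspace_def by blast+
  ultimately show ?thesis
    by (intro matv.subspaceI) (simp_all add: MsetE_iff)
qed

lemma MsetE_range:
  assumes "A \<in> MsetE f E"
  shows "range ((*v) A) = (*v) A ` grad_space f"
proof -
  have "A *v v = A *v (E *v v)" for v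
    using MsetE_absorb(1)[OF assms] by (simp add: matrix_vector_mul_assoc)
  then show ?thesis
    using range_grad_space by blast
qed

lemma gam_MsetE:
  assumes "A \<in> MsetE f E"
  shows "gam d f A \<in> homog d" "coeff_grad (gam d f A) \<gamma> = A *v coeff_grad f \<gamma>"
    "grad_space (gam d f A) = range ((*v) A)"
proof -
  have A: "A \<in> Mset f"
    using assms by (simp add: MsetE_iff)
  have "d > 0"
    using degree by simp
  note gam = gam_props[OF this homog A]
  show "gam d f A \<in> homog d" "coeff_grad (gam d f A) \<gamma> = A *v coeff_grad f \<gamma>"
    by (rule gam)+
  show "grad_space (gam d f A) = range ((*v) A)"
    unfolding MsetE_range[OF assms] by (rule grad_space_image) (rule gam)
qed

lemma inj_on_gam: "inj_on (gam d f) (MsetE f E)"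
proof (rule inj_onI)
  fix A B
  assume "A \<in> MsetE f E" "B \<in> MsetE f E" "gam d f A = gam d f B"
  then show "A = B"
    using gam_MsetE(2) by (metis MsetE_eqI)
qed

subsection \<open>Orthogonal idempotents and regular splittings\<close>

lemma orth_idempotents_mult:
  assumes "orth_idempotents f E n Es" "i \<in> {1..n}" "j \<in> {1..n}"
  shows "Es i ** Es j = (if i = j then Es i else 0)"
proof (cases "i = j")
  case True
  have "Es i = Es i ** (\<Sum>k\<in>{1..n}. Es k)"
    using assms MsetE_absorb(1) by (auto simp: orth_idempotents_def)
  also have "\<dots> = (\<Sum>k\<in>{1..n}. Es i ** Es k)"
    by (rule sum_matrix_mult_left)
  also have "\<dots> = (\<Sum>k\<in>{1..n}. if k = i then Es i ** Es i else 0)"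
    using assms by (intro sum.cong refl) (auto simp: orth_idempotents_def)
  also have "\<dots> = Es i ** Es i"
    using assms(2) by simp
  finally show ?thesis
    using True by simp
qed (use assms in \<open>auto simp: orth_idempotents_def\<close>)

text \<open>
  \<open>Es i\<close> is the identity on its own image and zero on the other images, so these images, which are
  the gradient spaces of the summands, are independent.
\<close>

lemma regular_splitting_of_idempotents:
  assumes Es: "orth_idempotents f E n Es"
  shows "regular_splitting d f n (\<lambda>i. gam d f (Es i))"
proof -
  let ?g = "\<lambda>i. gam d f (Es i)"
  have E_i: "Es i \<in> MsetE f E" "Es i \<noteq> 0" if "i \<in> {1..n}" for i
    using Es that by (auto simp: orth_idempotents_def)
  note g = gam_MsetE[OF E_i(1)]
  have "f = (\<Sum>i\<in>{1..n}. ?g i)"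
  proof (rule homog_eqI[OF homog])
    show "(\<Sum>i\<in>{1..n}. ?g i) \<in> homog d"
      by (rule pm.subspace_sum[OF subspace_homog]) (rule g)
    have "(\<Sum>i\<in>{1..n}. Es i *v coeff_grad f \<gamma>) = E *v coeff_grad f \<gamma>" for \<gamma>
      using Es by (simp add: orth_idempotents_def flip: sum_matrix_vector)
    then show "coeff_grad f \<gamma> = coeff_grad (\<Sum>i\<in>{1..n}. ?g i) \<gamma>" for \<gamma>
      by (simp add: coeff_grad_sum g)
  qed (use degree in simp)
  moreover have "?g i \<noteq> 0" if i: "i \<in> {1..n}" for i
  proof
    assume "?g i = 0"
    then have "Es i *v coeff_grad f \<gamma> = 0 *v coeff_grad f \<gamma>" for \<gamma>
      using g(2)[OF i, of \<gamma>] by simp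
    then have "Es i = 0"
      by (rule MsetE_eqI[OF E_i(1)[OF i] matv.subspace_0[OF subspace_MsetE]])
    then show False
      using E_i(2)[OF i] by simp
  qed
  moreover have "grad_space (?g i) \<inter> subspace_sum ({1..n} - {i}) (\<lambda>j. grad_space (?g j)) = {0}"
    if i: "i \<in> {1..n}" for i
  proof (intro equalityI subsetI)
    fix x
    assume x: "x \<in> grad_space (?g i) \<inter> subspace_sum ({1..n} - {i}) (\<lambda>j. grad_space (?g j))"
    then obtain v where v: "x = (\<Sum>j\<in>{1..n} - {i}. v j)" "\<And>j. j \<in> {1..n} - {i} \<Longrightarrow> v j \<in> grad_space (?g j)"
      by (auto simp: subspace_sum_def)
    have "Es i *v v j = 0" if j: "j \<in> {1..n} - {i}" for j
    proof -
      obtain w where "v j = Es j *v w"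
        using v(2)[OF j] g(3)[of j] j by auto
      then show ?thesis
        using orth_idempotents_mult[OF Es i, of j] j by (simp add: matrix_vector_mul_assoc)
    qed
    then have "Es i *v x = 0"
      by (simp add: v(1) vec.sum)
    moreover obtain w where "x = Es i *v w"
      using x g(3)[OF i] by auto
    ultimately show "x \<in> {0}"
      using orth_idempotents_mult[OF Es i i] by (simp add: matrix_vector_mul_assoc)
  qed (auto intro!: vec.subspace_0 subspace_subspace_sum)
  ultimately show ?thesis
    using degree g(1) by (subst regular_splitting_iff) auto
qed

text \<open>
  The idempotents are the projections \<open>P i\<close> onto the gradient spaces of the summands, composed
  with \<open>E\<close>. Since \<open>P i\<close> maps the gradient of \<open>f\<close> to that of \<open>g i\<close>, it belongs to \<open>Mset f\<close>;
  in particular it preserves \<open>grad_space f\<close>, which therefore contains all the gradient spaces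
  of the summands.
\<close>

lemma idempotents_of_regular_splitting:
  assumes "regular_splitting d f n g"
  obtains Es where "orth_idempotents f E n Es" "\<And>i. i \<in> {1..n} \<Longrightarrow> gam d f (Es i) = g i"
proof -
  have d: "d > 0"
    using degree by simp
  have f_eq: "f = (\<Sum>i\<in>{1..n}. g i)"
    and g: "\<And>i. i \<in> {1..n} \<Longrightarrow> g i \<noteq> 0 \<and> g i \<in> homog d"
    and disj: "\<And>i. i \<in> {1..n} \<Longrightarrow>
      grad_space (g i) \<inter> subspace_sum ({1..n} - {i}) (\<lambda>j. grad_space (g j)) = {0}"
    using assms unfolding regular_splitting_iff[OF d] by auto
  have "\<exists>P. (\<forall>v\<in>grad_space (g i). P *v v = v) \<and>
      (\<forall>j\<in>{1..n} - {i}. \<forall>v\<in>grad_space (g j). P *v v = 0)" if i: "i \<in> {1..n}" for i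
  proof -
    obtain P where P: "\<And>v. v \<in> grad_space (g i) \<Longrightarrow> P *v v = v"
      "\<And>u. u \<in> subspace_sum ({1..n} - {i}) (\<lambda>j. grad_space (g j)) \<Longrightarrow> P *v u = 0"
      using ex_projection[OF subspace_grad_space subspace_subspace_sum disj[OF i]] by auto
    show ?thesis
      using P(1) subset_subspace_sum[of "{1..n} - {i}" _ "\<lambda>j. grad_space (g j)"]
      by (intro exI[of _ P]) (auto intro!: P(2))
  qed
  then obtain P where P: "\<And>i v. i \<in> {1..n} \<Longrightarrow> v \<in> grad_space (g i) \<Longrightarrow> P i *v v = v"
    "\<And>i j v. i \<in> {1..n} \<Longrightarrow> j \<in> {1..n} - {i} \<Longrightarrow> v \<in> grad_space (g j) \<Longrightarrow> P i *v v = 0"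
    by metis
  have P_grad: "P i *v coeff_grad f \<gamma> = coeff_grad (g i) \<gamma>" if i: "i \<in> {1..n}" for i \<gamma>
  proof -
    have "P i *v coeff_grad f \<gamma> = (\<Sum>j\<in>{1..n}. P i *v coeff_grad (g j) \<gamma>)"
      by (subst f_eq) (simp add: coeff_grad_sum vec.sum)
    also have "\<dots> = (\<Sum>j\<in>{1..n}. if j = i then coeff_grad (g i) \<gamma> else 0)"
      using i by (intro sum.cong refl) (auto simp: P)
    finally show ?thesis
      using i by simp
  qed
  have P_Mset: "P i \<in> Mset f" if "i \<in> {1..n}" for i
    using that by (simp add: Mset_iff P_grad coeff_grad_swap)
  define Es where "Es i = P i ** E" for i
  have Es: "Es i \<in> MsetE f E" if "i \<in> {1..n}" for i
    using P_Mset[OF that] by (auto simp: Es_def MsetE_eq)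
  have Es_grad: "Es i *v coeff_grad f \<gamma> = coeff_grad (g i) \<gamma>" if "i \<in> {1..n}" for i \<gamma>
    by (simp add: Es_def P_grad[OF that] flip: matrix_vector_mul_assoc)
  have "orth_idempotents f E n Es"
    unfolding orth_idempotents_def
  proof (intro conjI ballI impI)
    fix i
    assume i: "i \<in> {1..n}"
    show "Es i \<in> MsetE f E"
      by (rule Es[OF i])
    show "Es i \<noteq> 0"
    proof
      assume "Es i = 0"
      then have "coeff_grad (g i) \<gamma> = coeff_grad 0 \<gamma>" for \<gamma>
        using Es_grad[OF i, of \<gamma>] by simp
      then have "g i = 0"
        using g[OF i] d pm.subspace_0[OF subspace_homog] by (intro homog_eqI[of "g i" d 0]) auto
      then show False
        using g[OF i] by simp
    qed
  next
    show "(\<Sum>i\<in>{1..n}. Es i) = E"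
    proof (rule MsetE_eqI[OF _ E_in_MsetE])
      show "(\<Sum>i\<in>{1..n}. Es i) \<in> MsetE f E"
        by (rule matv.subspace_sum[OF subspace_MsetE]) (rule Es)
      show "(\<Sum>i\<in>{1..n}. Es i) *v coeff_grad f \<gamma> = E *v coeff_grad f \<gamma>" for \<gamma>
      proof -
        have "(\<Sum>i\<in>{1..n}. Es i) *v coeff_grad f \<gamma> = coeff_grad (\<Sum>i\<in>{1..n}. g i) \<gamma>"
          by (simp add: sum_matrix_vector Es_grad coeff_grad_sum)
        then show ?thesis
          by (simp only: f_eq[symmetric] E_coeff_grad)
      qed
    qed
  next
    fix i j
    assume ij: "i \<in> {1..n}" "j \<in> {1..n}" "i \<noteq> j"
    have "P i *v (E *v (P j *v (E *v v))) = 0" for v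
    proof -
      have "E *v (P j *v (E *v v)) = P j *v (E *v v)"
        by (intro fixes_grad_space Mset_grad_space[OF degree homog P_Mset[OF ij(2)]] range_grad_space)
      moreover have "P j *v (E *v v) \<in> grad_space (g j)"
        using range_grad_space[of v] grad_space_image[of "g j" "P j" f] P_grad[OF ij(2)] by simp
      ultimately show ?thesis
        using P(2)[of i j] ij by simp
    qed
    then show "Es i ** Es j = 0"
      by (simp add: Es_def matrix_eq flip: matrix_vector_mul_assoc)
  qed
  moreover have "gam d f (Es i) = g i" if "i \<in> {1..n}" for i
    using g[OF that] by (intro gam_eqI[OF d]) (simp_all add: Es_grad[OF that])
  ultimately show thesis
    by (rule that)
qed

lemma bij_betw_Coid_Reg: "bij_betw (\<lambda>S. gam d f ` S) (Coid f E) (Reg d f)"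
proof (rule bij_betw_imageI)
  have "Coid f E \<subseteq> Pow (MsetE f E)"
    by (auto simp: Coid_def orth_idempotents_def)
  then show "inj_on (\<lambda>S. gam d f ` S) (Coid f E)"
    using inj_on_gam inj_on_image_Pow inj_on_subset by blast
  show "(\<lambda>S. gam d f ` S) ` Coid f E = Reg d f"
  proof (intro equalityI subsetI)
    fix G
    assume "G \<in> (\<lambda>S. gam d f ` S) ` Coid f E"
    then obtain n Es where "orth_idempotents f E n Es" "G = gam d f ` Es ` {1..n}"
      by (auto simp: Coid_def)
    then show "G \<in> Reg d f"
      using regular_splitting_of_idempotents unfolding Reg_def image_image by blast
  next
    fix G
    assume "G \<in> Reg d f"
    then obtain n g where g: "regular_splitting d f n g" "G = g ` {1..n}"
      by (auto simp: Reg_def)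
    then obtain Es where Es: "orth_idempotents f E n Es" "\<And>i. i \<in> {1..n} \<Longrightarrow> gam d f (Es i) = g i"
      using idempotents_of_regular_splitting by blast
    have "G = gam d f ` Es ` {1..n}"
      unfolding g(2) image_image by (rule image_cong) (simp_all add: Es(2))
    then show "G \<in> (\<lambda>S. gam d f ` S) ` Coid f E"
      using Es(1) unfolding Coid_def by blast
  qed
qed

end


section \<open>Primitive idempotents and the maximal splitting\<close>

context grad_projection
begin

text \<open>
  Nonzero vectors chosen in the images of orthogonal idempotents are linearly independent.
\<close>

lemma orth_idempotents_length:
  assumes Es: "orth_idempotents f E n Es"
  shows "n \<le> CARD('n)"
proof -
  have "\<exists>v. Es i *v v \<noteq> 0" if "i \<in> {1..n}" for i
    using Es that by (auto simp: orth_idempotents_def matrix_eq)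
  then obtain v where v: "\<And>i. i \<in> {1..n} \<Longrightarrow> Es i *v v i \<noteq> 0"
    by metis
  define x where "x i = Es i *v v i" for i
  have Es_x: "Es i *v x j = (if i = j then x i else 0)" if "i \<in> {1..n}" "j \<in> {1..n}" for i j
    using orth_idempotents_mult[OF Es that] by (simp add: x_def matrix_vector_mul_assoc)
  have inj: "inj_on x {1..n}"
    by (rule inj_onI) (metis Es_x v x_def)
  have "vec.independent (x ` {1..n})"
  proof (rule vec.independent_if_scalars_zero)
    fix c y
    assume c: "(\<Sum>y\<in>x ` {1..n}. c y *s y) = 0" and "y \<in> x ` {1..n}"
    then obtain i where i: "i \<in> {1..n}" "y = x i"
      by blast
    have "0 = Es i *v (\<Sum>j\<in>{1..n}. c (x j) *s x j)"
      using c unfolding sum.reindex[OF inj] comp_def by simp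
    also have "\<dots> = (\<Sum>j\<in>{1..n}. if j = i then c (x i) *s x i else 0)"
      using i(1) by (simp only: vec.sum vec.scale) (intro sum.cong refl, auto simp: Es_x)
    also have "\<dots> = c y *s y"
      using i by simp
    finally show "c y = 0"
      using v[OF i(1)] i(2) by (simp add: x_def)
  qed simp
  then have "card (x ` {1..n}) \<le> vec.dim (UNIV :: ('a ^ 'n) set)"
    by (intro vec.independent_card_le_dim) auto
  then show ?thesis
    unfolding card_image[OF inj] vec_dim_card by simp
qed

lemma MsetE_mult:
  assumes "d \<ge> 3" "A \<in> MsetE f E" "B \<in> MsetE f E"
  shows "A ** B \<in> MsetE f E" "A ** B = B ** A"
proof -
  have AB: "A ** B \<in> MsetE f E" if "A \<in> MsetE f E" "B \<in> MsetE f E" for A B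
    using that Mset_mult[OF assms(1) homog] by (simp add: MsetE_iff flip: matrix_mul_assoc)
  show "A ** B \<in> MsetE f E"
    by (rule AB[OF assms(2,3)])
  have "A \<in> Mset f" "B \<in> Mset f"
    using assms by (auto simp: MsetE_iff)
  then show "A ** B = B ** A"
    using assms by (intro MsetE_eqI AB)
      (simp_all add: Mset_commute[OF assms(1) homog] flip: matrix_vector_mul_assoc)
qed

lemma commutative_MsetE:
  assumes "d \<ge> 3"
  shows "commutative_matrix_algebra (MsetE f E) E"
  unfolding commutative_matrix_algebra_def
  using subspace_MsetE MsetE_mult[OF assms] E_in_MsetE MsetE_absorb by blast

text \<open>
  Otherwise \<open>Es i\<close> is the sum of the two nonzero orthogonal idempotents \<open>Es i ** e\<close> and
  \<open>Es i - Es i ** e\<close>, which replace it in a longer family. Commutativity makes the product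
  idempotent.
\<close>

lemma maximal_imp_primitive:
  assumes d: "d \<ge> 3"
    and Es: "orth_idempotents f E n Es"
    and maximal: "\<And>m Fs. orth_idempotents f E m Fs \<Longrightarrow> m \<le> n"
    and e: "e \<in> MsetE f E" "e ** e = e"
    and i: "i \<in> {1..n}"
  shows "Es i ** e = 0 \<or> Es i ** e = Es i"
proof (rule ccontr)
  assume split: "\<not> (Es i ** e = 0 \<or> Es i ** e = Es i)"
  define x where "x = Es i ** e"
  define y where "y = Es i - Es i ** e"
  define Fs where "Fs k = (if k = i then x else if k = Suc n then y else Es k)" for k
  have E_k: "Es k \<in> MsetE f E" "Es k \<noteq> 0" if "k \<in> {1..n}" for k
    using Es that by (auto simp: orth_idempotents_def)
  note mult = orth_idempotents_mult[OF Es]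
  have comm: "Es i ** e = e ** Es i"
    by (rule MsetE_mult(2)[OF d E_k(1)[OF i] e(1)])
  have x: "x \<in> MsetE f E"
    unfolding x_def by (rule MsetE_mult(1)[OF d E_k(1)[OF i] e(1)])
  have y: "y \<in> MsetE f E"
    using matv.subspace_diff[OF subspace_MsetE E_k(1)[OF i] x] by (simp add: x_def y_def)
  have diff_mult: "(A - B) ** C = A ** C - B ** C" "C ** (A - B) = C ** A - C ** B"
    for A B C :: "'a ^ 'n ^ 'n"
    by (simp_all add: matrix_eq matrix_vector_mult_diff_rdistrib matrix_vector_mult_diff_distrib
        flip: matrix_vector_mul_assoc)
  have Ex: "Es i ** x = x" "x ** Es i = x"
    using mult[OF i i] by (simp_all add: x_def matrix_mul_assoc)
      (simp add: comm flip: matrix_mul_assoc)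
  have Ey: "Es i ** y = y" "y ** Es i = y"
    using Ex mult[OF i i] by (simp_all add: y_def diff_mult x_def)
  have "x ** x = Es i ** (e ** Es i) ** e"
    by (simp add: x_def matrix_mul_assoc)
  also have "\<dots> = (Es i ** Es i) ** (e ** e)"
    by (simp only: comm[symmetric] matrix_mul_assoc)
  also have "\<dots> = x"
    using mult[OF i i] by (simp add: e(2) x_def)
  finally have xx: "x ** x = x" .
  have y_eq: "y = Es i - x"
    by (simp add: x_def y_def)
  have xy: "x ** y = 0" "y ** x = 0"
    using Ex xx by (simp_all add: y_eq diff_mult)
  \<comment> \<open>The two halves inherit orthogonality to the other members from \<open>Es i\<close>.\<close>
  have other: "z ** Es k = 0" "Es k ** z = 0"
    if "k \<in> {1..n}" "k \<noteq> i" "Es i ** z = z" "z ** Es i = z" for z k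
  proof -
    have "z ** Es k = z ** (Es i ** Es k)" "Es k ** z = (Es k ** Es i) ** z"
      using that(3,4) by (metis matrix_mul_assoc)+
    then show "z ** Es k = 0" "Es k ** z = 0"
      using mult[OF i that(1)] mult[OF that(1) i] that(2) by simp_all
  qed
  have "orth_idempotents f E (Suc n) Fs"
    unfolding orth_idempotents_def
  proof (intro conjI ballI impI)
    fix k
    assume "k \<in> {1..Suc n}"
    then have "k = Suc n \<or> k \<in> {1..n}"
      by auto
    then show "Fs k \<noteq> 0" "Fs k \<in> MsetE f E"
      using split x y E_k by (auto simp: Fs_def x_def y_def)
  next
    have "(\<Sum>k\<in>{1..Suc n}. Fs k) = (\<Sum>k\<in>{1..n}. Fs k) + y"
      using i by (simp add: Fs_def)
    also have "(\<Sum>k\<in>{1..n}. Fs k) = x + (\<Sum>k\<in>{1..n} - {i}. Fs k)"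
      using i by (subst sum.remove[of _ i]) (simp_all add: Fs_def)
    also have "(\<Sum>k\<in>{1..n} - {i}. Fs k) = (\<Sum>k\<in>{1..n} - {i}. Es k)"
      by (intro sum.cong) (auto simp: Fs_def)
    also have "x + (\<Sum>k\<in>{1..n} - {i}. Es k) + y = (\<Sum>k\<in>{1..n}. Es k)"
      using i by (subst (2) sum.remove[of _ i]) (simp_all add: y_eq)
    also have "\<dots> = E"
      using Es by (simp add: orth_idempotents_def)
    finally show "(\<Sum>k\<in>{1..Suc n}. Fs k) = E" .
  next
    fix k l
    assume "k \<in> {1..Suc n}" "l \<in> {1..Suc n}" and kl: "k \<noteq> l"
    then have "k = Suc n \<or> k \<in> {1..n}" "l = Suc n \<or> l \<in> {1..n}"
      by auto
    then show "Fs k ** Fs l = 0"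
      using kl i xy other[OF _ _ Ex] other[OF _ _ Ey] mult[of k l]
      by (auto simp: Fs_def)
  qed
  then have "Suc n \<le> n"
    by (rule maximal)
  then show False
    by simp
qed

text \<open>
  For each \<open>i\<close>, the products \<open>Es i ** Fs j\<close> are zero or \<open>Es i\<close> and add up to \<open>Es i\<close>, so some \<open>j\<close>
  gives \<open>Es i\<close>; orthogonality of the \<open>Fs j\<close> makes it unique. This \<open>j\<close> is \<open>\<phi> i\<close>.
\<close>

lemma primitive_imp_refines:
  assumes d: "d \<ge> 3"
    and Es: "orth_idempotents f E n Es"
    and primitive: "\<And>e i. e \<in> MsetE f E \<Longrightarrow> e ** e = e \<Longrightarrow> i \<in> {1..n} \<Longrightarrow>
      Es i ** e = 0 \<or> Es i ** e = Es i"
    and Fs: "orth_idempotents f E m Fs"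
  shows "\<exists>\<phi>. \<phi> ` {1..n} = {1..m} \<and>
    (\<forall>j\<in>{1..m}. Fs j = (\<Sum>i\<in>{i\<in>{1..n}. \<phi> i = j}. Es i))"
proof -
  have E_i: "Es i \<in> MsetE f E" "Es i \<noteq> 0" if "i \<in> {1..n}" for i
    using Es that by (auto simp: orth_idempotents_def)
  have F_j: "Fs j \<in> MsetE f E" "Fs j \<noteq> 0" if "j \<in> {1..m}" for j
    using Fs that by (auto simp: orth_idempotents_def)
  have dichotomy: "Es i ** Fs j = 0 \<or> Es i ** Fs j = Es i" if "i \<in> {1..n}" "j \<in> {1..m}" for i j
    using primitive F_j(1) orth_idempotents_mult[OF Fs] that by simp
  have "\<exists>j\<in>{1..m}. Es i ** Fs j \<noteq> 0" if i: "i \<in> {1..n}" for i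
  proof (rule ccontr)
    assume "\<not> (\<exists>j\<in>{1..m}. Es i ** Fs j \<noteq> 0)"
    then have "Es i ** (\<Sum>j\<in>{1..m}. Fs j) = 0"
      by (simp add: sum_matrix_mult_left)
    then show False
      using Fs E_i[OF i] by (simp add: orth_idempotents_def MsetE_absorb)
  qed
  then obtain \<phi> where \<phi>: "\<And>i. i \<in> {1..n} \<Longrightarrow> \<phi> i \<in> {1..m}" "\<And>i. i \<in> {1..n} \<Longrightarrow> Es i ** Fs (\<phi> i) = Es i"
    using dichotomy by metis
  have Es_Fs: "Es i ** Fs j = (if \<phi> i = j then Es i else 0)" if "i \<in> {1..n}" "j \<in> {1..m}" for i j
  proof (cases "\<phi> i = j")
    case False
    have "Es i ** Fs j = Es i ** (Fs (\<phi> i) ** Fs j)"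
      using \<phi>(2)[OF that(1)] by (simp add: matrix_mul_assoc)
    then show ?thesis
      using orth_idempotents_mult[OF Fs \<phi>(1)[OF that(1)] that(2)] False by simp
  qed (use that \<phi> in auto)
  have Fs_eq: "Fs j = (\<Sum>i\<in>{i\<in>{1..n}. \<phi> i = j}. Es i)" if j: "j \<in> {1..m}" for j
  proof -
    have "Fs j = (\<Sum>i\<in>{1..n}. Es i) ** Fs j"
      using Es F_j[OF j] by (simp add: orth_idempotents_def MsetE_absorb)
    also have "\<dots> = (\<Sum>i\<in>{1..n}. if \<phi> i = j then Es i else 0)"
      unfolding sum_matrix_mult_right by (intro sum.cong refl Es_Fs j)
    finally show ?thesis
      by (simp only: sum.inter_filter[OF finite_atLeastAtMost])
  qed
  have "{1..m} \<subseteq> \<phi> ` {1..n}"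
  proof (rule subsetI, rule ccontr)
    fix j
    assume j: "j \<in> {1..m}" "j \<notin> \<phi> ` {1..n}"
    then have "{i\<in>{1..n}. \<phi> i = j} = {}"
      by blast
    then show False
      using Fs_eq[OF j(1)] F_j(2)[OF j(1)] by (metis sum.empty)
  qed
  then have "\<phi> ` {1..n} = {1..m}"
    using \<phi>(1) by blast
  then show ?thesis
    using Fs_eq by blast
qed

text \<open>
  The lengths are bounded, and there is at least one family: the one that comes from \<open>f\<close> as its
  own only summand (or from the empty splitting of \<open>0\<close>).
\<close>

lemma ex_maximal_orth_idempotents:
  obtains n Es where "orth_idempotents f E n Es" "\<And>m Fs. orth_idempotents f E m Fs \<Longrightarrow> m \<le> n"
proof -
  have "regular_splitting d f (if f = 0 then 0 else 1) (\<lambda>_. f)"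
    using degree homog
    by (subst regular_splitting_iff) (auto simp: subspace_sum_def vec.subspace_0)
  then obtain n0 Es0 where "orth_idempotents f E n0 Es0"
    using idempotents_of_regular_splitting by blast
  then have ex: "\<exists>Es. orth_idempotents f E n0 Es"
    by blast
  have bounded: "m \<le> CARD('n)" if "\<exists>Fs. orth_idempotents f E m Fs" for m
    using that orth_idempotents_length by blast
  define n where "n = (GREATEST n. \<exists>Es. orth_idempotents f E n Es)"
  obtain Es where "orth_idempotents f E n Es"
    using GreatestI_nat[of "\<lambda>n. \<exists>Es. orth_idempotents f E n Es", OF ex bounded] by (auto simp: n_def)
  moreover have "m \<le> n" if "orth_idempotents f E m Fs" for m Fs
    unfolding n_def using that bounded by (intro Greatest_le_nat) auto
  ultimately show thesis
    by (rule that)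
qed

lemma maximal_regular_splitting:
  assumes d: "d \<ge> 3"
  obtains n g where "max_regular_splitting d f n g"
    "\<And>m h. regular_splitting d f m h \<Longrightarrow> grouping_of n g m h"
proof -
  obtain n Es where Es: "orth_idempotents f E n Es"
    and maximal: "\<And>m Fs. orth_idempotents f E m Fs \<Longrightarrow> m \<le> n"
    by (rule ex_maximal_orth_idempotents) blast
  have E_i: "Es i \<in> MsetE f E" if "i \<in> {1..n}" for i
    using Es that by (auto simp: orth_idempotents_def)
  have primitive: "Es i ** e = 0 \<or> Es i ** e = Es i"
    if "e \<in> MsetE f E" "e ** e = e" "i \<in> {1..n}" for e i
    using maximal that by (rule maximal_imp_primitive[OF d Es])
  let ?g = "\<lambda>i. gam d f (Es i)"
  have "max_regular_splitting d f n ?g"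
    unfolding max_regular_splitting_def
    using regular_splitting_of_idempotents[OF Es] idempotents_of_regular_splitting maximal by metis
  moreover have "grouping_of n ?g m h" if h: "regular_splitting d f m h" for m h
  proof -
    obtain Fs where Fs: "orth_idempotents f E m Fs" and gam_Fs: "\<And>j. j \<in> {1..m} \<Longrightarrow> gam d f (Fs j) = h j"
      using idempotents_of_regular_splitting[OF h] by blast
    obtain \<phi> where \<phi>: "\<phi> ` {1..n} = {1..m}"
      and Fs_eq: "\<And>j. j \<in> {1..m} \<Longrightarrow> Fs j = (\<Sum>i\<in>{i\<in>{1..n}. \<phi> i = j}. Es i)"
      using primitive_imp_refines[OF d Es primitive Fs] by blast
    have "h j = (\<Sum>i\<in>{i\<in>{1..n}. \<phi> i = j}. ?g i)" if j: "j \<in> {1..m}" for j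
    proof -
      have F_j: "Fs j \<in> MsetE f E"
        using Fs j by (auto simp: orth_idempotents_def)
      have "gam d f (Fs j) = (\<Sum>i\<in>{i\<in>{1..n}. \<phi> i = j}. ?g i)"
      proof (rule gam_eqI)
        show "(\<Sum>i\<in>{i\<in>{1..n}. \<phi> i = j}. ?g i) \<in> homog d"
          by (rule pm.subspace_sum[OF subspace_homog]) (auto intro!: gam_MsetE E_i)
        show "coeff_grad (\<Sum>i\<in>{i\<in>{1..n}. \<phi> i = j}. ?g i) \<gamma> = Fs j *v coeff_grad f \<gamma>" for \<gamma>
          unfolding Fs_eq[OF j] coeff_grad_sum sum_matrix_vector
          by (rule sum.cong[OF refl]) (auto intro!: gam_MsetE E_i)
      qed (use d in simp)
      then show ?thesis
        using gam_Fs[OF j] by simp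
    qed
    then show ?thesis
      unfolding grouping_of_def using \<phi> by blast
  qed
  ultimately show thesis
    by (rule that)
qed

end

text \<open>
  The map that defines the grouping is a surjection of \<open>{1..n}\<close> onto itself, hence a permutation.
\<close>

lemma grouping_of_same_length:
  assumes "grouping_of n g n h"
  shows "same_up_to_order n g n h"
proof -
  obtain \<phi> where \<phi>: "\<phi> ` {1..n} = {1..n}"
    and h: "\<And>j. j \<in> {1..n} \<Longrightarrow> h j = (\<Sum>i\<in>{i\<in>{1..n}. \<phi> i = j}. g i)"
    using assms unfolding grouping_of_def by blast
  have inj: "inj_on \<phi> {1..n}"
    by (rule eq_card_imp_inj_on) (simp_all only: \<phi> finite_atLeastAtMost)
  define \<sigma> where "\<sigma> = inv_into {1..n} \<phi>"
  have "bij_betw \<sigma> {1..n} {1..n}"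
    unfolding \<sigma>_def using inj \<phi> by (intro bij_betw_inv_into bij_betw_imageI)
  moreover have "h j = g (\<sigma> j)" if j: "j \<in> {1..n}" for j
  proof -
    have "\<sigma> j \<in> {1..n}" "\<phi> (\<sigma> j) = j"
      using j \<phi> by (metis \<sigma>_def inv_into_into, metis \<sigma>_def f_inv_into_f)
    then have "{i\<in>{1..n}. \<phi> i = j} = {\<sigma> j}"
      using inj by (auto dest: inj_onD)
    then show ?thesis
      using h[OF j] by simp
  qed
  ultimately show ?thesis
    unfolding same_up_to_order_def by blast
qed


section \<open>The algebras of the summands\<close>

context grad_projection
begin

lemma grad_projection_summand:
  assumes Es: "orth_idempotents f E n Es" and i: "i \<in> {1..n}"
  shows "grad_projection d (gam d f (Es i)) (Es i)"
proof
  have E_i: "Es i \<in> MsetE f E"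
    using Es i by (auto simp: orth_idempotents_def)
  show "2 \<le> d" "gam d f (Es i) \<in> homog d"
    by (rule degree, rule gam_MsetE[OF E_i])
  show "Es i *v w = w" if "w \<in> grad_space (gam d f (Es i))" for w
    using that gam_MsetE(3)[OF E_i] orth_idempotents_mult[OF Es i i]
    by (auto simp: matrix_vector_mul_assoc)
  show "Es i *v v \<in> grad_space (gam d f (Es i))" for v
    using gam_MsetE(3)[OF E_i] by blast
qed

text \<open>
  For \<open>A\<close> with \<open>A ** Es i = A\<close>, membership in \<open>Mset f\<close> and in \<open>Mset (gam d f (Es i))\<close> is the same;
  this reduces the first equation to closure of \<open>MsetE f E\<close> under products.
\<close>

lemma MsetE_summand:
  assumes d: "d \<ge> 3" and Es: "orth_idempotents f E n Es" and i: "i \<in> {1..n}"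
  shows "MsetE (gam d f (Es i)) (Es i) = {A ** Es i | A. A \<in> Mset f}"
    "{A ** Es i | A. A \<in> Mset f} = {A ** Es i | A. A \<in> MsetE f E}"
proof -
  have E_i: "Es i \<in> MsetE f E"
    using Es i by (auto simp: orth_idempotents_def)
  interpret summand: grad_projection d "gam d f (Es i)" "Es i"
    by (rule grad_projection_summand[OF Es i])
  have idem: "Es i ** Es i = Es i"
    by (rule summand.E_idempotent)
  \<comment> \<open>If \<open>A ** Es i = A\<close>, then \<open>A\<close> acts in the same way on the gradients of \<open>f\<close> and of the summand.\<close>
  have transfer: "A \<in> Mset (gam d f (Es i)) \<longleftrightarrow> A \<in> Mset f" if "A ** Es i = A" for A
    by (rule Mset_transfer) (simp add: gam_MsetE(2)[OF E_i] matrix_vector_mul_assoc that)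
  have shift: "A ** Es i = (A ** E) ** Es i" "A ** E \<in> MsetE f E" if "A \<in> Mset f" for A
    using that MsetE_absorb(2)[OF E_i] by (auto simp: MsetE_eq simp flip: matrix_mul_assoc)
  show "MsetE (gam d f (Es i)) (Es i) = {A ** Es i | A. A \<in> Mset f}"
  proof (intro equalityI subsetI)
    fix B
    assume "B \<in> MsetE (gam d f (Es i)) (Es i)"
    then have "B ** Es i = B" "B \<in> Mset f"
      using transfer by (auto simp: summand.MsetE_iff)
    then show "B \<in> {A ** Es i | A. A \<in> Mset f}"
      by (metis (mono_tags, lifting) mem_Collect_eq)
  next
    fix B
    assume "B \<in> {A ** Es i | A. A \<in> Mset f}"
    then obtain A where A: "A \<in> Mset f" "B = A ** Es i"
      by blast
    then have "B \<in> MsetE f E"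
      using shift[of A] MsetE_mult(1)[OF d _ E_i] by metis
    moreover have "B ** Es i = B"
      by (simp add: A(2) idem flip: matrix_mul_assoc)
    ultimately show "B \<in> MsetE (gam d f (Es i)) (Es i)"
      using transfer by (simp add: summand.MsetE_iff MsetE_iff)
  qed
  show "{A ** Es i | A. A \<in> Mset f} = {A ** Es i | A. A \<in> MsetE f E}"
    using shift by (auto simp: MsetE_iff)
qed

text \<open>
  The component of \<open>A\<close> in the \<open>i\<close>-th summand is \<open>A ** Es i\<close>; multiplication by \<open>Es k\<close> recovers the
  \<open>k\<close>-th component from the sum.
\<close>

lemma MsetE_direct_sum:
  assumes d: "d \<ge> 3" and Es: "orth_idempotents f E n Es"
  shows "matrix_direct_sum (MsetE f E) {1..n} (\<lambda>i. MsetE (gam d f (Es i)) (Es i))"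
proof -
  let ?W = "\<lambda>i. MsetE (gam d f (Es i)) (Es i)"
  note W = MsetE_summand[OF d Es]
  have E_i: "Es i \<in> MsetE f E" if "i \<in> {1..n}" for i
    using Es that by (auto simp: orth_idempotents_def)
  have W_iff: "B \<in> ?W i \<longleftrightarrow> B \<in> MsetE f E \<and> B ** Es i = B" if i: "i \<in> {1..n}" for B i
  proof
    assume "B \<in> ?W i"
    then obtain A where A: "A \<in> MsetE f E" "B = A ** Es i"
      using W[OF i] by auto
    then show "B \<in> MsetE f E \<and> B ** Es i = B"
      using MsetE_mult(1)[OF d A(1) E_i[OF i]] orth_idempotents_mult[OF Es i i]
      by (simp flip: matrix_mul_assoc)
  next
    assume "B \<in> MsetE f E \<and> B ** Es i = B"
    then show "B \<in> ?W i"
      unfolding W[OF i] by (metis (mono_tags, lifting) mem_Collect_eq)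
  qed
  have component: "(\<Sum>i\<in>{1..n}. v i) ** Es k = v k" if v: "v \<in> Pi\<^sub>E {1..n} ?W" and k: "k \<in> {1..n}" for v k
  proof -
    have "v i ** Es k = (if i = k then v k else 0)" if i: "i \<in> {1..n}" for i
    proof -
      have "v i ** Es i = v i"
        using v i W_iff by blast
      then have "v i ** Es k = v i ** (Es i ** Es k)"
        by (simp add: matrix_mul_assoc)
      then show ?thesis
        using orth_idempotents_mult[OF Es i k] \<open>v i ** Es i = v i\<close> by auto
    qed
    then have "(\<Sum>i\<in>{1..n}. v i) ** Es k = (\<Sum>i\<in>{1..n}. if i = k then v k else 0)"
      by (simp add: sum_matrix_mult_right)
    then show ?thesis
      using k by simp
  qed
  have "bij_betw (\<lambda>v. \<Sum>i\<in>{1..n}. v i) (Pi\<^sub>E {1..n} ?W) (MsetE f E)"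
  proof (rule bij_betw_imageI)
    show "inj_on (\<lambda>v. \<Sum>i\<in>{1..n}. v i) (Pi\<^sub>E {1..n} ?W)"
    proof (rule inj_onI)
      fix v w
      assume v: "v \<in> Pi\<^sub>E {1..n} ?W" and w: "w \<in> Pi\<^sub>E {1..n} ?W"
        and eq: "(\<Sum>i\<in>{1..n}. v i) = (\<Sum>i\<in>{1..n}. w i)"
      show "v = w"
      proof (rule PiE_ext[OF v w])
        fix k
        assume k: "k \<in> {1..n}"
        show "v k = w k"
          unfolding component[OF v k, symmetric] component[OF w k, symmetric] eq by (rule refl)
      qed
    qed
    show "(\<lambda>v. \<Sum>i\<in>{1..n}. v i) ` Pi\<^sub>E {1..n} ?W = MsetE f E"
    proof (intro equalityI subsetI)
      fix A
      assume "A \<in> (\<lambda>v. \<Sum>i\<in>{1..n}. v i) ` Pi\<^sub>E {1..n} ?W"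
      then obtain v where v: "v \<in> Pi\<^sub>E {1..n} ?W" "A = (\<Sum>i\<in>{1..n}. v i)"
        by blast
      have "v i \<in> MsetE f E" if "i \<in> {1..n}" for i
        using PiE_mem[OF v(1) that] W_iff[OF that] by simp
      then show "A \<in> MsetE f E"
        unfolding v(2) by (rule matv.subspace_sum[OF subspace_MsetE])
    next
      fix A
      assume A: "A \<in> MsetE f E"
      let ?v = "restrict (\<lambda>i. A ** Es i) {1..n}"
      have "(\<Sum>i\<in>{1..n}. ?v i) = A ** (\<Sum>i\<in>{1..n}. Es i)"
        by (simp add: sum_matrix_mult_left)
      then have "A = (\<Sum>i\<in>{1..n}. ?v i)"
        using Es MsetE_absorb(1)[OF A] by (simp add: orth_idempotents_def)
      moreover have "A ** Es i \<in> ?W i" if "i \<in> {1..n}" for i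
        unfolding W[OF that] using A by blast
      then have "?v \<in> Pi\<^sub>E {1..n} ?W"
        by (simp only: restrict_PiE_iff) blast
      ultimately show "A \<in> (\<lambda>v. \<Sum>i\<in>{1..n}. v i) ` Pi\<^sub>E {1..n} ?W"
        by blast
    qed
  qed
  moreover have "matv.subspace (?W i)" if "i \<in> {1..n}" for i
    by (rule grad_projection.subspace_MsetE[OF grad_projection_summand[OF Es that]])
  ultimately show ?thesis
    by (simp add: matrix_direct_sum_def)
qed

end

text \<open>
  \<open>E\<close> fixes \<open>grad_space f\<close>, which is therefore contained in the image of \<open>E\<close>; the rank condition
  forces equality.
\<close>

lemma grad_projectionI:
  fixes f :: "('a::field, 'n::finite) divpow"
  assumes d: "d \<ge> 2" and f: "f \<in> homog d"
    and E: "mat_app E (grad f) = grad f"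
    and rank: "rank E = pm.dim (derivs (d - 1) f)"
  shows "grad_projection d f E"
proof -
  have "E *v coeff_grad f \<gamma> = coeff_grad f \<gamma>" for \<gamma>
    using E grad_eq_mat_app_iff[of f E f] by simp
  then have fixes_w: "E *v w = w" if "w \<in> grad_space f" for w
    using eq_on_grad_space[of E f "mat 1" w] that by simp
  then have "grad_space f \<subseteq> range ((*v) E)"
    by (metis rangeI subsetI)
  moreover have "vec.dim (range ((*v) E)) \<le> vec.dim (grad_space f)"
    using dim_range_le_rank[of E] dim_derivs[OF f] d rank by simp
  moreover have "vec.subspace (range ((*v) E))"
    by (rule vec.linear_subspace_image) auto
  ultimately have "range ((*v) E) = grad_space f"
    by (metis subspace_grad_space vec.subspace_dim_equal)
  then show ?thesis
    using d f fixes_w by unfold_locales auto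
qed

theorem theorem3p18:
  fixes f :: "('a::field, 'n::finite) divpow"
    and E :: "'a ^ 'n ^ 'n"
    and d :: nat
  assumes "d \<ge> 2"
    and "f \<in> homog d"
    and "f \<noteq> 0"
    and "E \<in> Mset f"
    and "mat_app E (grad f) = grad f"
    and "rank E = pm.dim (derivs (d - 1) f)"
  shows
    "bij_betw (\<lambda>S. gam d f ` S) (Coid f E) (Reg d f) \<and>
     (d \<ge> 3 \<longrightarrow>
        commutative_matrix_algebra (MsetE f E) E \<and>
        (\<exists>n g. max_regular_splitting d f n g \<and>
           (\<forall>m h. max_regular_splitting d f m h \<longrightarrow> same_up_to_order n g m h) \<and>
           (\<forall>m h. regular_splitting d f m h \<longrightarrow> grouping_of n g m h)) \<and>
        (\<forall>n Es. orth_idempotents f E n Es \<longrightarrow>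
           (\<forall>i\<in>{1..n}.
              MsetE (gam d f (Es i)) (Es i) = {A ** Es i | A. A \<in> Mset f} \<and>
              {A ** Es i | A. A \<in> Mset f} = {A ** Es i | A. A \<in> MsetE f E}) \<and>
           matrix_direct_sum (MsetE f E) {1..n} (\<lambda>i. MsetE (gam d f (Es i)) (Es i))))"
proof -
  interpret grad_projection d f E
    using assms(1,2,5,6) by (rule grad_projectionI)
  have "\<exists>n g. max_regular_splitting d f n g \<and>
      (\<forall>m h. max_regular_splitting d f m h \<longrightarrow> same_up_to_order n g m h) \<and>
      (\<forall>m h. regular_splitting d f m h \<longrightarrow> grouping_of n g m h)" if d: "d \<ge> 3"
  proof -
    obtain n g where g: "max_regular_splitting d f n g"
      and grouping: "\<And>m h. regular_splitting d f m h \<Longrightarrow> grouping_of n g m h"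
      using maximal_regular_splitting[OF d] by blast
    have "same_up_to_order n g m h" if h: "max_regular_splitting d f m h" for m h
    proof -
      have "m = n"
        using g h unfolding max_regular_splitting_def by (meson le_antisym)
      moreover have "grouping_of n g m h"
        using h grouping by (simp add: max_regular_splitting_def)
      ultimately show ?thesis
        using grouping_of_same_length by blast
    qed
    then show ?thesis
      using g grouping by blast
  qed
  then show ?thesis
    using bij_betw_Coid_Reg commutative_MsetE MsetE_summand MsetE_direct_sum by (intro conjI impI allI ballI) auto
qed

end
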